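(* Let $m\ge1$, $N=2^m$. Random (uniform) sampling from the Clifford group $\mathrm{Cliff}_N$, taken modulo scalars, gives a unitary $3$-design. Random (uniform) sampling from the group $\mathfrak{P}_{\mathrm{K},m}$, followed by a uniformly random Pauli matrix $D(a,b)$, gives a unitary $2$-design; the same holds for $\mathfrak{P}_{\mathrm{K},m}^*$. Here, for $\mathfrak{P}\in\{\mathfrak{P}_{\mathrm{K},m},\mathfrak{P}_{\mathrm{K},m}^*\}$, sampling means: for each $F\in\mathfrak{P}$ fix a Clifford element $g_F\in\mathrm{Cliff}_N$ that induces $F$, and consider the uniform ensemble of the unitaries $D(a,b)\,g_F$ with $F\in\mathfrak{P}$ and $a,b\in\mathbb{F}_2^m$.
   Context: With $X=\begin{bmatrix} 0 & 1 \\ 1 & 0 \end{bmatrix}$, $Z=\begin{bmatrix} 1 & 0 \\ 0 & -1 \end{bmatrix}$ and $a,b\in\mathbb{F}_2^m$, $D(a,b)=X^{a_1}Z^{b_1}\otimes\cdots\otimes X^{a_m}Z^{b_m}$; $HW_N=\{\imath^\kappa D(a,b):\kappa\in\mathbb{Z}_4\}$; $E(a,b)=\imath^{ab^T}D(a,b)$ (exponent computed over the integers, mod 4). $\mathrm{Cliff}_N$ is the group of all $N\times N$ unitary $g$ with $gD(a,b)g^\dagger\in HW_N$ for all $a,b$; modulo unit-modulus scalars it is finite, and sampling uniformly means choosing a uniformly random class modulo scalars and any representative (the twirl below does not depend on the representative). Each $g\in\mathrm{Cliff}_N$ induces a binary symplectic matrix $F_g\in\mathrm{Sp}(2m,\mathbb{F}_2)$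 by $gE(a,b)g^\dagger=\pm E([a,b]F_g)$, and every element of $\mathrm{Sp}(2m,\mathbb{F}_2)$ is induced by some $g$. Field setup: $\mathbb{F}_{2^m}$ is obtained from $\mathbb{F}_2$ by adjoining a root $\alpha$ of a primitive irreducible polynomial of degree $m$; elements are identified with row vectors in $\mathbb{F}_2^m$ via the basis $1,\alpha,\ldots,\alpha^{m-1}$. $W$ is the invertible binary symmetric matrix with $\mathrm{Tr}(xy)=xWy^T$; $A_z$ is defined by $xA_z=xz$; $R$ by $xR=x^2$. $\Omega=\begin{bmatrix} 0 & I_m \\ I_m & 0 \end{bmatrix}$; $L_Q=\begin{bmatrix} Q & 0 \\ 0 & Q^{-T} \end{bmatrix}$ for $Q$ invertible ($Q^{-T}=(Q^{-1})^T$); $T_P=\begin{bmatrix} I_m & P \\ 0 & I_m \end{bmatrix}$ for $P=P^T$. $\mathfrak{P}_{\mathrm{K},m}$ is the group generated by $T_{A_x^2W}$ ($x\in\mathbb{F}_{2^m}$), $L_{A_x^{-1}}$ ($x\neq0$) and $\Omega L_{W^{-1}}$; $\mathfrak{P}_{\mathrm{K},m}^*$ is the group generated by $T_{A_x^2W}$ ($x\in\mathbb{F}_{2^m}$), $L_{R^{-i}A_x^{-1}}$ ($x\neq0$, $i\in\{0,\ldots,m-1\}$) and $\Omega L_{W^{-1}}$. An ensemble $\{p_i,U_i\}_{i=1}^n$ of $N\times N$ unitary matrices with probabilities $p_i$ is a unitary $k$-design if for all linear operators $\mathcal{X}$ on $(\mathbb{C}^N)^{\otimes k}$, $\sum_{i}p_i\,U_i^{\otimes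 k}\mathcal{X}(U_i^\dagger)^{\otimes k}=\int_{\mathbb{U}_N}U^{\otimes k}\mathcal{X}(U^\dagger)^{\otimes k}\,d\eta(U)$, with $\eta$ the Haar probability measure on the unitary group $\mathbb{U}_N$. *)

theory Defs
  imports
    "HOL-Probability.Probability_Measure"
    "HOL-Analysis.Analysis"
    "HOL-Computational_Algebra.Polynomial"
    "HOL-Library.Z2"
    "HOL-Algebra.Generated_Groups"
begin

section \<open>Complex matrices, tensor products, unitary designs\<close>

lemma UNIV_bit: "(UNIV :: bit set) = {0, 1}"
  by (auto intro: bit_not_one_iff[THEN iffD1])

instance bit :: finite
  by standard (metis UNIV_bit finite.emptyI finite_insert)

definition cscale :: "complex \<Rightarrow> complex^'n^'n \<Rightarrow> complex^'n^'n"
  where "cscale c A = map_matrix (\<lambda>z. c * z) A"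

definition dagger :: "complex^'n^'n \<Rightarrow> complex^'n^'n"
  where "dagger A = transpose (map_matrix cnj A)"

definition unitary_mat :: "complex^'n^'n \<Rightarrow> bool"
  where "unitary_mat U \<longleftrightarrow> U ** dagger U = mat 1 \<and> dagger U ** U = mat 1"

text \<open>The tensor product of a family of matrices indexed by \<open>'k\<close>. The standard basis of the
  tensor product of \<open>CARD('k)\<close> copies of \<open>\<complex>^'n\<close> is indexed by \<open>'n^'k\<close>, the tuples of basis
  indices of the factors.\<close>

definition tensor :: "('k::finite \<Rightarrow> complex^'n^'n) \<Rightarrow> complex^('n^'k)^('n^'k)"
  where "tensor M = (\<chi> u v. \<Prod>i\<in>UNIV. M i $ (u $ i) $ (v $ i))"

abbreviation tensor_power :: "complex^'n^'n \<Rightarrow> complex^('n^'k::finite)^('n^'k)"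
  where "tensor_power U \<equiv> tensor (\<lambda>_::'k. U)"

text \<open>The Haar probability measure on the unitary group: the left-invariant Borel probability
  measure (by compactness it exists, is unique, and is right-invariant as well).\<close>

definition haar_unitary :: "(complex^'n^'n) measure \<Rightarrow> bool"
  where "haar_unitary \<eta> \<longleftrightarrow>
    prob_space \<eta> \<and>
    sets \<eta> = sets (restrict_space borel {U. unitary_mat U}) \<and>
    (\<forall>V S. unitary_mat V \<longrightarrow> S \<in> sets \<eta> \<longrightarrow> emeasure \<eta> ((\<lambda>U. V ** U) ` S) = emeasure \<eta> S)"

text \<open>\<open>{p i, U i}\<close> for \<open>i \<in> I\<close> is a unitary \<open>CARD('k)\<close>-design. Being an ensemble at all (finite,
  weights a probability distribution, unitary members) is part of the notion.\<close>

definition unitary_design ::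
  "'k::finite itself \<Rightarrow> (complex^'n^'n) measure \<Rightarrow> 'i set \<Rightarrow> ('i \<Rightarrow> real) \<Rightarrow> ('i \<Rightarrow> complex^'n^'n) \<Rightarrow> bool"
  where "unitary_design (_ :: 'k itself) \<eta> I p U \<longleftrightarrow>
    finite I \<and> (\<forall>i\<in>I. 0 \<le> p i) \<and> (\<Sum>i\<in>I. p i) = 1 \<and> (\<forall>i\<in>I. unitary_mat (U i)) \<and>
    (\<forall>X :: complex^('n^'k)^('n^'k).
      (\<Sum>i\<in>I. p i *\<^sub>R (tensor_power (U i) ** X ** tensor_power (dagger (U i)))) =
      (\<integral>V. tensor_power V ** X ** tensor_power (dagger V) \<partial>\<eta>))"

definition uniform_unitary_design ::
  "'k::finite itself \<Rightarrow> (complex^'n^'n) measure \<Rightarrow> 'i set \<Rightarrow> ('i \<Rightarrow> complex^'n^'n) \<Rightarrow> bool"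
  where "uniform_unitary_design k \<eta> I U \<longleftrightarrow> unitary_design k \<eta> I (\<lambda>_. 1 / real (card I)) U"


section \<open>Heisenberg-Weyl and Clifford groups\<close>

text \<open>Qubits are indexed by a finite type \<open>'m\<close>, so \<open>m = CARD('m)\<close>; the computational basis of
  \<open>\<complex>^N\<close>, \<open>N = 2 ^ m\<close>, is indexed by \<open>bit^'m\<close>.\<close>

type_synonym 'm bits = "(bit, 'm) vec"
type_synonym 'm bmat = "((bit, 'm) vec, 'm) vec"
type_synonym 'm sp_mat = "('m + 'm) bmat"
type_synonym 'm qop = "((complex, 'm bits) vec, 'm bits) vec"

definition pauli_X :: "complex^bit^bit"
  where "pauli_X = (\<chi> u v. if u = v then 0 else 1)"

definition pauli_Z :: "complex^bit^bit"
  where "pauli_Z = (\<chi> u v. if u = v then (if u = 0 then 1 else -1) else 0)"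

definition bit_power :: "complex^bit^bit \<Rightarrow> bit \<Rightarrow> complex^bit^bit"
  where "bit_power A b = (if b = 1 then A else mat 1)"

definition pauli_D :: "'m::finite bits \<Rightarrow> 'm bits \<Rightarrow> 'm qop"
  where "pauli_D a b = tensor (\<lambda>i. bit_power pauli_X (a $ i) ** bit_power pauli_Z (b $ i))"

definition HW :: "('m::finite qop) set"
  where "HW = {cscale (\<i> ^ \<kappa>) (pauli_D a b) | \<kappa> a b. \<kappa> < (4::nat)}"

definition int_inner :: "'m::finite bits \<Rightarrow> 'm bits \<Rightarrow> nat"
  where "int_inner a b = (\<Sum>i\<in>UNIV. of_bit (a $ i) * of_bit (b $ i))"

definition pauli_E :: "'m::finite bits \<Rightarrow> 'm bits \<Rightarrow> 'm qop"
  where "pauli_E a b = cscale (\<i> ^ int_inner a b) (pauli_D a b)"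

definition Cliff :: "('m::finite qop) set"
  where "Cliff = {g. unitary_mat g \<and> (\<forall>a b. g ** pauli_D a b ** dagger g \<in> HW)}"

definition cliff_phase_rel :: "('m::finite qop) rel"
  where "cliff_phase_rel = {(g, h). g \<in> Cliff \<and> h \<in> Cliff \<and> (\<exists>c. cmod c = 1 \<and> h = cscale c g)}"

text \<open>Row vectors \<open>[a, b]\<close> of length \<open>2m\<close> are indexed by \<open>'m + 'm\<close>.\<close>

definition row_pair :: "'m::finite bits \<Rightarrow> 'm bits \<Rightarrow> ('m + 'm) bits"
  where "row_pair a b = (\<chi> s. case s of Inl i \<Rightarrow> a $ i | Inr i \<Rightarrow> b $ i)"

definition row_fst :: "('m::finite + 'm) bits \<Rightarrow> 'm bits"
  where "row_fst w = (\<chi> i. w $ Inl i)"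

definition row_snd :: "('m::finite + 'm) bits \<Rightarrow> 'm bits"
  where "row_snd w = (\<chi> i. w $ Inr i)"

definition induces :: "'m::finite qop \<Rightarrow> 'm sp_mat \<Rightarrow> bool"
  where "induces g F \<longleftrightarrow> (\<forall>a b.
    let w = row_pair a b v* F; E' = pauli_E (row_fst w) (row_snd w)
    in g ** pauli_E a b ** dagger g = E' \<or> g ** pauli_E a b ** dagger g = - E')"


section \<open>The field with \<open>2 ^ m\<close> elements\<close>

text \<open>For irreducible \<open>q\<close>, primitivity says that the class of the variable modulo \<open>q\<close> has
  multiplicative order exactly \<open>2 ^ degree q - 1\<close>.\<close>

definition primitive_irreducible :: "bit poly \<Rightarrow> bool"
  where "primitive_irreducible q \<longleftrightarrow> irreducible q \<and>
    q dvd monom 1 (2 ^ degree q - 1) - 1 \<and>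
    (\<forall>k. 0 < k \<and> k < 2 ^ degree q - 1 \<longrightarrow> \<not> q dvd monom 1 k - 1)"

definition eval_bit_poly :: "bit poly \<Rightarrow> 'f::field \<Rightarrow> 'f"
  where "eval_bit_poly p x = poly (map_poly of_bit p) x"

text \<open>The whole field \<open>'f\<close> is \<open>\<bbbF>\<^sub>2(\<alpha>)\<close> with \<open>\<alpha>\<close> a root of \<open>q\<close>.\<close>

definition adjoins_root :: "bit poly \<Rightarrow> 'f::field \<Rightarrow> bool"
  where "adjoins_root q \<alpha> \<longleftrightarrow>
    CHAR('f) = 2 \<and> eval_bit_poly q \<alpha> = 0 \<and> (\<forall>x. \<exists>p. x = eval_bit_poly p \<alpha>)"

text \<open>The order on the index type numbers the coordinates \<open>0, \<dots>, m - 1\<close>.\<close>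

definition pos :: "'m::{finite,linorder} \<Rightarrow> nat"
  where "pos i = card {j. j < i}"

definition elt :: "'f::field \<Rightarrow> 'm::{finite,linorder} bits \<Rightarrow> 'f"
  where "elt \<alpha> x = (\<Sum>i\<in>UNIV. of_bit (x $ i) * \<alpha> ^ pos i)"

definition coords :: "'f::field \<Rightarrow> 'f \<Rightarrow> 'm::{finite,linorder} bits"
  where "coords \<alpha> = the_inv (elt \<alpha>)"

text \<open>The matrix of a linear map acting on row vectors from the right.\<close>

definition row_matrix :: "('m::finite bits \<Rightarrow> 'm bits) \<Rightarrow> 'm bmat"
  where "row_matrix f = transpose (matrix f)"

definition A_mat :: "'f::field \<Rightarrow> 'f \<Rightarrow> 'm::{finite,linorder} bmat"
  where "A_mat \<alpha> z = row_matrix (\<lambda>x. coords \<alpha> (elt \<alpha> x * z))"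

definition R_mat :: "'f::field \<Rightarrow> 'm::{finite,linorder} bmat"
  where "R_mat \<alpha> = row_matrix (\<lambda>x. coords \<alpha> ((elt \<alpha> x)\<^sup>2))"

definition field_trace :: "nat \<Rightarrow> 'f::field \<Rightarrow> 'f"
  where "field_trace m x = (\<Sum>i<m. x ^ (2 ^ i))"

definition W_mat :: "'f::field \<Rightarrow> 'm::{finite,linorder} bmat"
  where "W_mat \<alpha> =
    (\<chi> i j. if field_trace CARD('m) (\<alpha> ^ pos i * \<alpha> ^ pos j) = 0 then 0 else 1)"

text \<open>The defining properties \<open>x A\<^sub>z = x z\<close>, \<open>x R = x\<^sup>2\<close> and \<open>Tr (x y) = x W y\<^sup>T\<close> are the lemmas
  \<open>A_mat_works\<close>, \<open>R_mat_works\<close> and \<open>W_mat_works\<close> below; \<open>bij_elt\<close> is the identification of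
  field elements with row vectors.\<close>

lemma row_matrix_works:
  fixes f :: "'m::finite bits \<Rightarrow> 'm bits"
  assumes add: "\<And>x y. f (x + y) = f x + f y"
  shows "x v* row_matrix f = f x"
proof -
  have f0: "f 0 = 0" using add[of 0 0] by simp
  have sc: "f (c *s y) = c *s f y" for c y
    by (cases c) (simp_all add: f0)
  have "Vector_Spaces.linear (*s) (*s) f"
    by (simp add: Vector_Spaces.linear_def module_hom_def module_hom_axioms_def add sc
        vec.vector_space_axioms vec.module_axioms)
  then show ?thesis
    by (simp add: row_matrix_def vector_transpose_matrix matrix_works)
qed

lemma of_bit_add:
  assumes "CHAR('f::field) = 2"
  shows "(of_bit (a + b) :: 'f) = of_bit a + of_bit b"
proof -
  have "(of_nat 2 :: 'f) = 0" using assms by (metis of_nat_CHAR)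
  then have "(1 :: 'f) + 1 = 0" by simp
  then show ?thesis by (cases a; cases b) simp_all
qed

lemma of_bit_mult: "(of_bit (a * b) :: 'f::field) = of_bit a * of_bit b"
  by (cases a; cases b) simp_all

lemma of_bit_sum:
  assumes "CHAR('f::field) = 2"
  shows "(of_bit (sum h S) :: 'f) = (\<Sum>i\<in>S. of_bit (h i))"
proof (induction S rule: infinite_finite_induct)
  case (insert x F)
  then show ?case by (simp only: sum.insert of_bit_add[OF assms] not_False_eq_True)
qed simp_all

lemma eval_add:
  assumes "CHAR('f::field) = 2"
  shows "eval_bit_poly (p + r) (x::'f) = eval_bit_poly p x + eval_bit_poly r x"
proof -
  have "map_poly of_bit (p + r) = (map_poly of_bit p + map_poly of_bit r :: 'f poly)"
    by (intro poly_eqI) (simp only: coeff_map_poly coeff_add of_bit_add[OF assms] even_zero not_True_eq_False of_bool_eq)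
  then show ?thesis by (simp add: eval_bit_poly_def)
qed

lemma eval_mult:
  assumes "CHAR('f::field) = 2"
  shows "eval_bit_poly (p * r) (x::'f) = eval_bit_poly p x * eval_bit_poly r x"
proof -
  have "map_poly of_bit (p * r) = (map_poly of_bit p * map_poly of_bit r :: 'f poly)"
    by (intro poly_eqI) (simp only: coeff_map_poly coeff_mult of_bit_sum[OF assms] of_bit_mult even_zero not_True_eq_False of_bool_eq)
  then show ?thesis by (simp add: eval_bit_poly_def)
qed

lemma bij_pos: "bij_betw (pos :: 'm::{finite,linorder} \<Rightarrow> nat) UNIV {..<CARD('m)}"
proof -
  have lt: "pos i < pos j" if "i < j" for i j :: 'm
    unfolding pos_def by (rule psubset_card_mono) (use that in auto)
  have inj: "inj (pos :: 'm \<Rightarrow> nat)"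
    by (rule injI) (metis lt less_irrefl linorder_less_linear)
  have "pos i < CARD('m)" for i :: 'm
    unfolding pos_def by (rule psubset_card_mono) auto
  then have "range (pos :: 'm \<Rightarrow> nat) \<subseteq> {..<CARD('m)}" by auto
  moreover have "card (range (pos :: 'm \<Rightarrow> nat)) = CARD('m)" using inj by (rule card_image)
  ultimately have "range (pos :: 'm \<Rightarrow> nat) = {..<CARD('m)}"
    by (intro card_subset_eq) auto
  with inj show ?thesis by (simp add: bij_betw_def)
qed

lemma elt_add:
  assumes "CHAR('f::field) = 2"
  shows "elt (\<alpha>::'f) (x + y) = elt \<alpha> x + elt \<alpha> y"
  by (simp only: elt_def vector_add_component of_bit_add[OF assms] distrib_right sum.distrib)

lemma elt_poly:
  fixes x :: "'m::{finite,linorder} bits" and \<alpha> :: "'f::field"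
  obtains p where "elt \<alpha> x = eval_bit_poly p \<alpha>" "p = 0 \<or> degree p < CARD('m)"
    "\<And>i. coeff p (pos i) = x $ i"
proof -
  define g where "g = inv_into UNIV (pos :: 'm \<Rightarrow> nat)"
  have g: "g (pos i) = i" for i using bij_pos unfolding g_def bij_betw_def by (auto intro: inv_into_f_f)
  define p where "p = (\<Sum>k<CARD('m). monom (x $ g k) k)"
  have c: "coeff p k = (if k < CARD('m) then x $ g k else 0)" for k
    by (simp add: p_def coeff_sum if_distrib sum.delta cong: if_cong)
  have deg: "p = 0 \<or> degree p < CARD('m)"
    by (metis c leading_coeff_0_iff)
  have pl: "pos i < CARD('m)" for i :: 'm using bij_pos unfolding bij_betw_def by auto
  have "eval_bit_poly p \<alpha> = (\<Sum>k<CARD('m). of_bit (coeff p k) * \<alpha> ^ k)"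
  proof -
    have "\<forall>k\<ge>CARD('m). coeff (map_poly of_bit p :: 'f poly) k = 0"
      by (simp add: coeff_map_poly c)
    then have "degree (map_poly of_bit p :: 'f poly) < CARD('m)"
      by (metis degree_0 leading_coeff_0_iff not_less zero_less_card_finite)
    then have "eval_bit_poly p \<alpha> = (\<Sum>k<CARD('m). coeff (map_poly of_bit p) k * \<alpha> ^ k)"
      unfolding eval_bit_poly_def poly_altdef
      by (intro sum.mono_neutral_left) (auto simp: coeff_eq_0 not_le intro: coeff_eq_0)
    then show ?thesis by (simp add: coeff_map_poly)
  qed
  also have "\<dots> = elt \<alpha> x"
    unfolding elt_def by (rule sum.reindex_bij_betw[OF bij_pos, symmetric, THEN trans]) (simp add: c g pl)
  finally show thesis using deg c g pl by (intro that[of p]) auto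
qed


lemma eval_smaller_root_zero:
  fixes \<alpha> :: "'f::field"
  assumes char: "CHAR('f) = 2" and irr: "irreducible q" and root: "eval_bit_poly q \<alpha> = 0"
    and p: "eval_bit_poly p \<alpha> = 0" "p = 0 \<or> degree p < degree q"
  shows "p = 0"
proof (rule ccontr)
  assume "p \<noteq> 0"
  define P where "P r \<longleftrightarrow> r \<noteq> 0 \<and> eval_bit_poly r \<alpha> = 0" for r
  have "P p" using \<open>p \<noteq> 0\<close> p by (simp add: P_def)
  then obtain r where r: "P r" and min: "\<And>s. P s \<Longrightarrow> degree r \<le> degree s"
    using arg_min_natI[of P p degree] arg_min_nat_le[of P _ degree] by blast
  have "q = (q div r) * r + q mod r" by simp
  then have "eval_bit_poly q \<alpha> =
      eval_bit_poly (q div r) \<alpha> * eval_bit_poly r \<alpha> + eval_bit_poly (q mod r) \<alpha>"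
    by (metis eval_add[OF char] eval_mult[OF char])
  then have "eval_bit_poly (q mod r) \<alpha> = 0" using root r by (simp add: P_def)
  then have "q mod r = 0"
    using min degree_mod_less[of r q] r by (metis P_def not_less)
  then have q: "q = r * (q div r)" by (metis mod_0_imp_dvd dvd_mult_div_cancel)
  have "\<not> is_unit r"
  proof
    assume "is_unit r"
    then obtain s where "r * s = 1" by (metis dvdE)
    then have "eval_bit_poly r \<alpha> * eval_bit_poly s \<alpha> = eval_bit_poly 1 \<alpha>"
      by (metis eval_mult[OF char])
    moreover have "eval_bit_poly 1 \<alpha> = 1" by (simp add: eval_bit_poly_def)
    ultimately show False using r by (simp add: P_def)
  qed
  then have "is_unit (q div r)" using irr q by (metis irreducibleD)
  then have "degree (q div r) = 0" "q div r \<noteq> 0"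
    by (auto simp: is_unit_poly_iff)
  moreover have "r \<noteq> 0" using r by (simp add: P_def)
  ultimately have "degree q = degree r" using q by (metis degree_mult_eq add.right_neutral)
  then show False using min[OF \<open>P p\<close>] p(2) \<open>p \<noteq> 0\<close> by simp
qed

lemma bij_elt:
  fixes \<alpha> :: "'f::field"
  assumes irr: "irreducible q" and deg: "degree q = CARD('m)" and adj: "adjoins_root q \<alpha>"
  shows "bij (elt \<alpha> :: 'm::{finite,linorder} bits \<Rightarrow> 'f)"
proof -
  have char: "CHAR('f) = 2" and root: "eval_bit_poly q \<alpha> = 0"
    and gen: "\<And>x. \<exists>p. x = eval_bit_poly p \<alpha>"
    using adj by (auto simp: adjoins_root_def)
  have zero: "x = 0" if "elt \<alpha> x = 0" for x :: "'m bits"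
  proof -
    obtain p where p: "elt \<alpha> x = eval_bit_poly p \<alpha>" "p = 0 \<or> degree p < CARD('m)"
      "\<And>i. coeff p (pos i) = x $ i"
      using elt_poly[of \<alpha> x] by metis
    have "p = 0"
      using eval_smaller_root_zero[OF char irr root] p that deg by metis
    then show ?thesis using p(3) by (simp add: vec_eq_iff) 
  qed
  have "inj (elt \<alpha> :: 'm bits \<Rightarrow> 'f)"
  proof (rule injI)
    fix x y :: "'m bits"
    assume "elt \<alpha> x = elt \<alpha> y"
    moreover have "y + y = 0" by (simp add: vec_eq_iff)
    ultimately have "elt \<alpha> (x + y) = 0"
      using elt_add[OF char, of \<alpha> x y] elt_add[OF char, of \<alpha> y y] by (simp add: elt_def)
    then have "x + y = 0" by (rule zero)
    then have "x + y + y = y" by simp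
    then show "x = y" using \<open>y + y = 0\<close> by (simp add: add.assoc)
  qed
  moreover have "\<exists>x :: 'm bits. z = elt \<alpha> x" for z
  proof -
    obtain p0 where p0: "z = eval_bit_poly p0 \<alpha>" using gen by blast
    define p where "p = p0 mod q"
    have "p0 = (p0 div q) * q + p" by (simp add: p_def)
    then have z: "z = eval_bit_poly p \<alpha>"
      using p0 root by (metis eval_add[OF char] eval_mult[OF char] add.left_neutral mult_zero_right)
    have q0: "q \<noteq> 0" using irr by auto
    have c: "coeff p k = 0" if "k \<ge> CARD('m)" for k
      using degree_mod_less[OF q0, of p0] deg that by (auto simp: p_def intro: coeff_eq_0)
    define x :: "'m bits" where "x = (\<chi> i. coeff p (pos i))"
    obtain r where r: "elt \<alpha> x = eval_bit_poly r \<alpha>" "r = 0 \<or> degree r < CARD('m)"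
      "\<And>i. coeff r (pos i) = x $ i"
      using elt_poly[of \<alpha> x] by metis
    have "coeff r k = coeff p k" for k
    proof (cases "k < CARD('m)")
      case True
      then obtain i :: 'm where "k = pos i" using bij_pos unfolding bij_betw_def by blast
      then show ?thesis using r(3) by (simp add: x_def)
    next
      case False
      then show ?thesis using r(2) c[of k] by (auto intro: coeff_eq_0)
    qed
    then have "r = p" by (rule poly_eqI)
    then show ?thesis using r(1) z by metis
  qed
  ultimately show ?thesis by (auto simp: bij_def surj_def)
qed

lemma elt_coords:
  fixes \<alpha> :: "'f::field"
  assumes "irreducible q" "degree q = CARD('m)" "adjoins_root q \<alpha>"
  shows "elt \<alpha> (coords \<alpha> z :: 'm::{finite,linorder} bits) = z"
  using bij_elt[OF assms] unfolding coords_def by (metis bij_def f_the_inv_into_f UNIV_I)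

lemma coords_add:
  fixes \<alpha> :: "'f::field"
  assumes "irreducible q" "degree q = CARD('m)" "adjoins_root q \<alpha>"
  shows "(coords \<alpha> (y + z) :: 'm::{finite,linorder} bits) = coords \<alpha> y + coords \<alpha> z"
proof -
  have char: "CHAR('f) = 2" using assms by (simp add: adjoins_root_def)
  have "elt \<alpha> (coords \<alpha> (y + z) :: 'm bits) = elt \<alpha> (coords \<alpha> y + coords \<alpha> z :: 'm bits)"
    by (simp only: elt_coords[OF assms] elt_add[OF char])
  then show ?thesis using bij_elt[OF assms] by (metis bij_def injD)
qed

lemma A_mat_works:
  fixes \<alpha> :: "'f::field" and x :: "'m::{finite,linorder} bits"
  assumes "irreducible q" "degree q = CARD('m)" "adjoins_root q \<alpha>"
  shows "elt \<alpha> (x v* A_mat \<alpha> z) = elt \<alpha> x * z"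
proof -
  have char: "CHAR('f) = 2" using assms by (simp add: adjoins_root_def)
  show ?thesis
    unfolding A_mat_def
    by (subst row_matrix_works) (simp_all only: elt_add[OF char] distrib_right coords_add[OF assms] elt_coords[OF assms])
qed

lemma char2_square_add:
  assumes "CHAR('f::field) = 2"
  shows "((a::'f) + b)\<^sup>2 = a\<^sup>2 + b\<^sup>2"
proof -
  have "(of_nat 2 :: 'f) = 0" using assms by (metis of_nat_CHAR)
  then show ?thesis by (simp add: power2_sum)
qed

lemma R_mat_works:
  fixes \<alpha> :: "'f::field" and x :: "'m::{finite,linorder} bits"
  assumes "irreducible q" "degree q = CARD('m)" "adjoins_root q \<alpha>"
  shows "elt \<alpha> (x v* R_mat \<alpha>) = (elt \<alpha> x)\<^sup>2"
proof -
  have char: "CHAR('f) = 2" using assms by (simp add: adjoins_root_def)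
  show ?thesis
    unfolding R_mat_def
    by (subst row_matrix_works) (simp_all only: elt_add[OF char] char2_square_add[OF char] coords_add[OF assms] elt_coords[OF assms])
qed

lemma frobenius_add:
  assumes "CHAR('f::field) = 2"
  shows "((a::'f) + b) ^ (2 ^ n) = a ^ (2 ^ n) + b ^ (2 ^ n)"
proof (induction n)
  case (Suc n)
  then show ?case by (simp only: power_Suc2 power_mult char2_square_add[OF assms])
qed simp

lemma field_trace_add:
  assumes "CHAR('f::field) = 2"
  shows "field_trace m ((a::'f) + b) = field_trace m a + field_trace m b"
  by (simp add: field_trace_def frobenius_add[OF assms] sum.distrib)

lemma field_power_card:
  fixes \<alpha> x :: "'f::field"
  assumes "irreducible q" "degree q = CARD('m::{finite,linorder})" "adjoins_root q \<alpha>"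
  shows "x ^ (2 ^ CARD('m)) = x"
proof -
  have bij: "bij (elt \<alpha> :: 'm bits \<Rightarrow> 'f)" by (rule bij_elt[OF assms])
  have bit2: "card (UNIV :: bit set) = 2"
    unfolding UNIV_bit by (simp del: bit_not_zero_iff)
  have fin: "finite (UNIV :: 'f set)"
    using bij_betw_finite[OF bij] by simp
  have card: "CARD('f) = 2 ^ CARD('m)"
    using bij_betw_same_card[OF bij] by (simp add: bit2)
  show ?thesis
  proof (cases "x = 0")
    case False
    have "(\<Prod>y\<in>UNIV - {0}. x * y) = \<Prod>(UNIV - {0})"
      by (rule prod.reindex_bij_witness[of _ "\<lambda>y. y / x" "\<lambda>y. x * y"]) (use False in auto)
    moreover have "(\<Prod>y\<in>UNIV - {0}. x * y) = x ^ (CARD('f) - 1) * \<Prod>(UNIV - {0})"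
      using fin by (simp add: prod.distrib)
    moreover have "\<Prod>(UNIV - {0 :: 'f}) \<noteq> 0" using fin by simp
    ultimately have "x ^ (CARD('f) - 1) = 1" by simp
    moreover have "CARD('f) = Suc (CARD('f) - 1)" using card by simp
    ultimately show ?thesis by (metis card power_Suc mult.right_neutral)
  qed (simp add: card)
qed

lemma field_trace_bit:
  fixes \<alpha> x :: "'f::field"
  assumes "irreducible q" "degree q = CARD('m::{finite,linorder})" "adjoins_root q \<alpha>"
  shows "field_trace CARD('m) x = 0 \<or> field_trace CARD('m) x = 1"
proof -
  have char: "CHAR('f) = 2" using assms by (simp add: adjoins_root_def)
  have sq: "(\<Sum>i\<in>S. h i)\<^sup>2 = (\<Sum>i\<in>S. (h i)\<^sup>2)" for h :: "nat \<Rightarrow> 'f" and S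
    by (induction S rule: infinite_finite_induct) (simp_all add: char2_square_add[OF char])
  let ?t = "field_trace CARD('m) x"
  have "?t\<^sup>2 = (\<Sum>i<CARD('m). x ^ (2 ^ Suc i))"
    by (simp only: field_trace_def sq power_Suc2 power_mult)
  also have "\<dots> + x = (\<Sum>i<Suc CARD('m). x ^ (2 ^ i))"
    by (subst sum.lessThan_Suc_shift) simp
  then have "(\<Sum>i<CARD('m). x ^ (2 ^ Suc i)) = ?t"
    using field_power_card[OF assms, of x] by (simp add: field_trace_def)
  finally have "?t * (?t - 1) = 0" by (simp add: power2_eq_square algebra_simps)
  then show ?thesis by simp
qed

lemma W_mat_works:
  fixes \<alpha> :: "'f::field" and x y :: "'m::{finite,linorder} bits"
  assumes "irreducible q" "degree q = CARD('m)" "adjoins_root q \<alpha>"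
  shows "field_trace CARD('m) (elt \<alpha> x * elt \<alpha> y) = of_bit (\<Sum>j\<in>UNIV. (x v* W_mat \<alpha>) $ j * y $ j)"
proof -
  have char: "CHAR('f) = 2" using assms by (simp add: adjoins_root_def)
  have tr0: "field_trace n (0::'f) = 0" for n
    by (simp add: field_trace_def power_0_left)
  have trs: "field_trace n (\<Sum>i\<in>S. h i) = (\<Sum>i\<in>S. field_trace n (h i))"
    for h :: "'m \<Rightarrow> 'f" and S n
    by (induction S rule: infinite_finite_induct) (simp_all add: field_trace_add[OF char] tr0)
  have trb: "field_trace n (of_bit b * z) = of_bit b * field_trace n z" for b n and z :: 'f
    by (cases b) (simp_all add: tr0)
  have W: "of_bit ((W_mat \<alpha> :: 'm bmat) $ i $ j) = field_trace CARD('m) (\<alpha> ^ pos i * \<alpha> ^ pos j)" for i j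
    using field_trace_bit[OF assms, of "\<alpha> ^ pos i * \<alpha> ^ pos j"] by (auto simp: W_mat_def)
  have "elt \<alpha> x * elt \<alpha> y =
      (\<Sum>i\<in>UNIV. \<Sum>j\<in>UNIV. of_bit (x $ i) * (of_bit (y $ j) * (\<alpha> ^ pos i * \<alpha> ^ pos j)))"
    by (simp only: elt_def sum_product mult.assoc mult.left_commute)
  then have "field_trace CARD('m) (elt \<alpha> x * elt \<alpha> y) =
      (\<Sum>i\<in>UNIV. \<Sum>j\<in>UNIV. of_bit (x $ i) * (of_bit (y $ j) * of_bit ((W_mat \<alpha> :: 'm bmat) $ i $ j)))"
    by (simp only: trs trb W)
  also have "\<dots> = (\<Sum>j\<in>UNIV. \<Sum>i\<in>UNIV. of_bit (x $ i) * (of_bit (y $ j) * of_bit ((W_mat \<alpha> :: 'm bmat) $ i $ j)))"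
    by (rule sum.swap)
  also have "\<dots> = of_bit (\<Sum>j\<in>UNIV. (x v* W_mat \<alpha>) $ j * y $ j)"
    by (simp only: vector_matrix_mult_def vec_lambda_beta of_bit_sum[OF char] of_bit_mult
        sum_distrib_left sum_distrib_right mult.commute mult.left_commute mult.assoc)
  finally show ?thesis .
qed


section \<open>The symplectic matrix groups\<close>

definition block_mat ::
  "'m::finite bmat \<Rightarrow> 'm bmat \<Rightarrow> 'm bmat \<Rightarrow> 'm bmat \<Rightarrow> 'm sp_mat"
  where "block_mat A B C D = (\<chi> s t.
    case s of
      Inl i \<Rightarrow> (case t of Inl j \<Rightarrow> A $ i $ j | Inr j \<Rightarrow> B $ i $ j)
    | Inr i \<Rightarrow> (case t of Inl j \<Rightarrow> C $ i $ j | Inr j \<Rightarrow> D $ i $ j))"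

definition Omega :: "'m::finite sp_mat"
  where "Omega = block_mat 0 (mat 1) (mat 1) 0"

definition L_mat :: "'m::finite bmat \<Rightarrow> 'm sp_mat"
  where "L_mat Q = block_mat Q 0 0 (transpose (matrix_inv Q))"

definition T_mat :: "'m::finite bmat \<Rightarrow> 'm sp_mat"
  where "T_mat P = block_mat (mat 1) P 0 (mat 1)"

definition mat_power :: "'m::finite bmat \<Rightarrow> nat \<Rightarrow> 'm bmat"
  where "mat_power A n = ((\<lambda>B. A ** B) ^^ n) (mat 1)"

definition GL :: "(bit^'n^'n) monoid"
  where "GL = \<lparr>carrier = {A. invertible A}, mult = (**), one = mat 1\<rparr>"

definition P_K :: "'f::field \<Rightarrow> ('m::{finite,linorder} sp_mat) set"
  where "P_K \<alpha> = generate GL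
    ({T_mat (A_mat \<alpha> x ** A_mat \<alpha> x ** W_mat \<alpha>) | x. True} \<union>
     {L_mat (matrix_inv (A_mat \<alpha> x)) | x. x \<noteq> 0} \<union>
     {Omega ** L_mat (matrix_inv (W_mat \<alpha>))})"

definition P_K_star :: "'f::field \<Rightarrow> ('m::{finite,linorder} sp_mat) set"
  where "P_K_star \<alpha> = generate GL
    ({T_mat (A_mat \<alpha> x ** A_mat \<alpha> x ** W_mat \<alpha>) | x. True} \<union>
     {L_mat (mat_power (matrix_inv (R_mat \<alpha>)) i ** matrix_inv (A_mat \<alpha> x)) | i x.
        i < CARD('m) \<and> x \<noteq> 0} \<union>
     {Omega ** L_mat (matrix_inv (W_mat \<alpha>))})"

end

theory Submission
  imports Defs
begin

text \<open>Averaging \<open>U\<^sup>\<otimes>\<^sup>k X (U\<^sup>\<dagger>)\<^sup>\<otimes>\<^sup>k\<close> over an ensemble agrees with the Haar average as soon as all ensemble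
  averages lie in the commutant of \<open>{U\<^sup>\<otimes>\<^sup>k}\<close>, and this has to be checked for tensor products \<open>X\<close> of
  Pauli matrices only. Averaging over Paulis kills such an \<open>X\<close> unless its labels sum to zero. For
  \<open>k = 2\<close> this leaves \<open>D(P) \<otimes> D(P)\<^sup>\<dagger>\<close>; if the symplectic group is transitive on nonzero labels, its
  average is independent of \<open>P \<noteq> 0\<close>, while the sum over all \<open>P\<close> is a multiple of the swap. For \<open>k = 3\<close>
  and the Clifford group, transvections \<open>(1 + \<i> E(V)) / \<surd>2\<close> are transitive on linearly independent pairs
  with a given symplectic product (Witt), and with \<open>S\<^sub>i\<^sub>j\<close> the swaps,
  \<open>\<Sum> D(P) \<otimes> D(Q) \<otimes> (D(P) D(Q))\<^sup>\<dagger>\<close> over all pairs is a multiple of \<open>S\<^sub>2\<^sub>3 S\<^sub>1\<^sub>3\<close>, and weighted with the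
  commutation sign it is a multiple of \<open>S\<^sub>1\<^sub>3 S\<^sub>2\<^sub>3\<close>; combining the two isolates each orbit.\<close>

section \<open>Matrices and tensor powers\<close>

text \<open>Conjugation by a Clifford element permutes Pauli matrices only up to phases. In every
  tensor that is averaged, the last factor is therefore the adjoint of the product of the others:
  the phases cancel and only the action on labels remains. So arbitrary representatives of the
  Clifford classes and arbitrary lifts \<open>g F\<close> can be used, although F \<mapsto>
  \<open>g F\<close> is in general not a homomorphism. Neither the commutant nor the Haar integral
  has to be computed. It is enough to recognise each orbit sum as a member of the commutant, and
  permutations of the tensor factors supply all members that occur. For \<open>k = 3\<close> the sum
  over all pairs of labels mixes the two values of the symplectic product; multiplying the same two
  swaps in the opposite order inserts exactly the commutation sign, which gives the second equation
  needed to separate them. Pairs with P = 0, Q = 0 or P = Q are linearly dependent, so Witt's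
  theorem does not cover them; there one of the three factors is scalar, and they reduce to the
  argument for two factors.\<close>

lemma cscale_nth [simp]: "cscale c A $ i $ j = c * A $ i $ j"
  by (simp add: cscale_def map_matrix_def)

lemma dagger_nth [simp]: "dagger A $ i $ j = cnj (A $ j $ i)"
  by (simp add: dagger_def transpose_def map_matrix_def)

lemma cscale_one [simp]: "cscale 1 A = A"
  and cscale_zero [simp]: "cscale 0 A = 0"
  and cscale_cscale [simp]: "cscale c (cscale d A) = cscale (c * d) A"
  by (simp_all add: vec_eq_iff)

lemma cscale_sum: "cscale c (\<Sum>x\<in>S. M x) = (\<Sum>x\<in>S. cscale c (M x))"
  by (simp add: vec_eq_iff sum_distrib_left)

lemma cscale_of_real: "cscale (of_real r) A = r *\<^sub>R A"
  by (simp only: vec_eq_iff cscale_nth vector_scaleR_component) (simp add: scaleR_conv_of_real)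

lemma cscale_mult_left: "cscale c A ** B = cscale c (A ** B)"
  and cscale_mult_right: "A ** cscale c B = cscale c (A ** B)"
  by (simp_all add: vec_eq_iff matrix_matrix_mult_def sum_distrib_left mult_ac)

lemma matrix_mult_sum_left: "(\<Sum>x\<in>S. M x) ** (B :: complex^'n^'n) = (\<Sum>x\<in>S. M x ** B)"
  by (simp add: vec_eq_iff matrix_matrix_mult_def sum_distrib_right sum.swap[of _ S])

lemma matrix_mult_sum_right: "(B :: complex^'n^'n) ** (\<Sum>x\<in>S. M x) = (\<Sum>x\<in>S. B ** M x)"
  by (simp add: vec_eq_iff matrix_matrix_mult_def sum_distrib_left sum.swap[of _ S])

lemma matrix_mult_add_left: "(A + B) ** (C :: complex^'n^'n) = A ** C + B ** C"
  and matrix_mult_diff_left: "(A - B) ** C = A ** C - B ** C"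
  and matrix_mult_diff_right: "C ** (A - B) = C ** A - C ** B"
  by (simp_all add: vec_eq_iff matrix_matrix_mult_def sum.distrib sum_subtractf algebra_simps)

lemma cmod_1_mult_cnj: "cmod c = 1 \<Longrightarrow> c * cnj c = 1"
  by (metis complex_norm_square of_real_1 power_one)

lemma dagger_dagger [simp]: "dagger (dagger A) = A"
  by (simp add: vec_eq_iff)

lemma dagger_mult: "dagger (A ** B) = dagger B ** dagger A"
  by (simp add: vec_eq_iff matrix_matrix_mult_def mult.commute)

lemma dagger_one [simp]: "dagger (mat 1) = mat 1"
  by (simp add: vec_eq_iff mat_def)

lemma dagger_cscale: "dagger (cscale c A) = cscale (cnj c) (dagger A)"
  by (simp add: vec_eq_iff)

lemma dagger_add: "dagger (A + B) = dagger A + dagger B"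
  by (simp add: vec_eq_iff)

lemma unitary_one: "unitary_mat (mat 1)"
  by (simp add: unitary_mat_def)

lemma unitary_dagger: "unitary_mat U \<Longrightarrow> unitary_mat (dagger U)"
  by (simp add: unitary_mat_def)

lemma unitary_mult:
  assumes "unitary_mat U" "unitary_mat V"
  shows "unitary_mat (U ** V)"
proof -
  have "U ** V ** (dagger V ** dagger U) = U ** (V ** dagger V) ** dagger U"
    and "dagger V ** dagger U ** (U ** V) = dagger V ** (dagger U ** U) ** V"
    by (simp_all add: matrix_mul_assoc)
  then show ?thesis using assms by (simp add: unitary_mat_def dagger_mult)
qed

lemma unitary_cancel:
  assumes "unitary_mat U"
  shows "dagger U ** (U ** A) = A" "U ** (dagger U ** A) = A"
    "A ** U ** dagger U = A" "A ** dagger U ** U = A"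
  using assms
  by (auto simp: unitary_mat_def matrix_mul_assoc) (auto simp: unitary_mat_def matrix_mul_assoc[symmetric])

section \<open>Tensor products\<close>

lemma tensor_nth [simp]: "tensor M $ u $ v = (\<Prod>i\<in>UNIV. M i $ (u $ i) $ (v $ i))"
  by (simp add: tensor_def)

text \<open>Distributivity of a product over sums, with choice functions written as tuples.
  Multiplicativity of \<open>tensor\<close> is this law applied to the intermediate index.\<close>

lemma sum_vec_prod:
  fixes h :: "'k::finite \<Rightarrow> 'a::finite \<Rightarrow> 'b::comm_semiring_1"
  shows "(\<Sum>w\<in>(UNIV :: ('a^'k) set). \<Prod>i\<in>UNIV. h i (w $ i)) = (\<Prod>i\<in>UNIV. \<Sum>x\<in>UNIV. h i x)"
proof -
  have "(\<Prod>i\<in>UNIV. \<Sum>x\<in>UNIV. h i x) = (\<Sum>f\<in>(UNIV :: ('k \<Rightarrow> 'a) set). \<Prod>i\<in>UNIV. h i (f i))"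
    by (simp add: prod_sum_PiE PiE_UNIV_domain)
  also have "\<dots> = (\<Sum>w\<in>(UNIV :: ('a^'k) set). \<Prod>i\<in>UNIV. h i (w $ i))"
    by (rule sum.reindex_bij_witness[of _ "\<lambda>w i. w $ i" vec_lambda]) auto
  finally show ?thesis by simp
qed

lemma tensor_mult: "tensor M ** tensor M' = tensor (\<lambda>i. M i ** M' i)"
proof -
  have "(tensor M ** tensor M') $ u $ v = tensor (\<lambda>i. M i ** M' i) $ u $ v" for u v
    using sum_vec_prod[of "\<lambda>i x. M i $ (u $ i) $ x * M' i $ x $ (v $ i)"]
    by (simp add: matrix_matrix_mult_def prod.distrib)
  then show ?thesis by (simp add: vec_eq_iff)
qed

lemma tensor_one: "tensor (\<lambda>_. mat 1) = mat 1"
  by (auto simp: vec_eq_iff mat_def)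

lemma tensor_dagger: "dagger (tensor M) = tensor (\<lambda>i. dagger (M i))"
  by (simp add: vec_eq_iff)

lemma tensor_cscale: "tensor (\<lambda>i. cscale (c i) (M i)) = cscale (\<Prod>i\<in>UNIV. c i) (tensor M)"
  by (simp add: vec_eq_iff prod.distrib)

section \<open>Conjugation by tensor powers and its fixed points\<close>

definition tensor_conj :: "complex^'n^'n \<Rightarrow> complex^('n::finite^'k::finite)^('n^'k) \<Rightarrow> complex^('n^'k)^('n^'k)"
  where "tensor_conj U X = tensor_power U ** X ** tensor_power (dagger U)"

lemma tensor_conj_nth: "tensor_conj U X $ u $ v =
   (\<Sum>w\<in>UNIV. (\<Sum>w'\<in>UNIV. (\<Prod>i\<in>UNIV. U $ (u $ i) $ (w' $ i)) * X $ w' $ w)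
     * (\<Prod>i\<in>UNIV. cnj (U $ (v $ i) $ (w $ i))))"
  by (simp add: tensor_conj_def matrix_matrix_mult_def)

lemma tensor_conj_cscale: "tensor_conj U (cscale c X) = cscale c (tensor_conj U X)"
  and tensor_conj_sum: "tensor_conj U (\<Sum>x\<in>S. M x) = (\<Sum>x\<in>S. tensor_conj U (M x))"
  by (simp_all add: tensor_conj_def cscale_mult_left cscale_mult_right matrix_mult_sum_left matrix_mult_sum_right)

lemma tensor_conj_scaleR: "tensor_conj U (r *\<^sub>R X) = r *\<^sub>R tensor_conj U X"
  by (simp add: cscale_of_real[symmetric] tensor_conj_cscale)

lemma tensor_conj_add: "tensor_conj U (X + Y) = tensor_conj U X + tensor_conj U Y"
  and tensor_conj_diff: "tensor_conj U (X - Y) = tensor_conj U X - tensor_conj U Y"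
  by (simp_all add: tensor_conj_def matrix_add_ldistrib matrix_mult_add_left matrix_mult_diff_left matrix_mult_diff_right)

lemma tensor_conj_mult:
  assumes "unitary_mat U"
  shows "tensor_conj U (X ** Y) = tensor_conj U X ** tensor_conj U Y"
proof -
  have "tensor_power U ** X ** tensor_power (dagger U) ** (tensor_power U ** Y ** tensor_power (dagger U)) =
    tensor_power U ** X ** (tensor_power (dagger U) ** tensor_power U) ** Y ** tensor_power (dagger U)"
    by (simp add: matrix_mul_assoc)
  then show ?thesis using assms
    by (simp add: tensor_conj_def tensor_mult unitary_mat_def tensor_one matrix_mul_assoc)
qed

lemma tensor_conj_dagger: "tensor_conj U (dagger X) = dagger (tensor_conj U X)"
  by (simp add: tensor_conj_def dagger_mult tensor_dagger matrix_mul_assoc)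

lemma tensor_conj_one: "unitary_mat U \<Longrightarrow> tensor_conj U (mat 1) = mat 1"
  by (simp add: tensor_conj_def tensor_mult unitary_mat_def tensor_one)

lemma tensor_conj_comp: "tensor_conj (U ** V) X = tensor_conj U (tensor_conj V X)"
  by (simp add: tensor_conj_def dagger_mult tensor_mult[symmetric] matrix_mul_assoc)

text \<open>The scalar enters once per factor and its conjugate equally often. This is the reason
  why twirls do not see the representative of a class modulo scalars.\<close>

lemma tensor_conj_phase:
  assumes "cmod c = 1"
  shows "tensor_conj (cscale c U) (X :: complex^('n::finite^'k::finite)^('n^'k)) = tensor_conj U X"
proof -
  have "c ^ CARD('k) * cnj c ^ CARD('k) = 1"
    using cmod_1_mult_cnj[OF assms] by (simp add: power_mult_distrib[symmetric])
  then show ?thesis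
    by (simp add: tensor_conj_def dagger_cscale tensor_cscale cscale_mult_left cscale_mult_right mult.commute)
qed

lemma tensor_conj_tensor: "tensor_conj U (tensor M) = tensor (\<lambda>i. U ** M i ** dagger U)"
  by (simp add: tensor_conj_def tensor_mult)

text \<open>Since conjugation is multiplicative and fixes D, the product with D can be taken before
  conjugating; the trace is invariant under conjugation.\<close>

lemma trace_tensor_conj:
  assumes "unitary_mat U" "tensor_conj U D = D"
  shows "trace (D ** tensor_conj U X) = trace (D ** X)"
proof -
  have "trace (D ** tensor_conj U X) = trace (tensor_conj U (D ** X))"
    using assms by (simp add: tensor_conj_mult)
  also have "\<dots> = trace (tensor_power (dagger U) ** (tensor_power U ** (D ** X)))"
    unfolding tensor_conj_def by (rule trace_mul_sym)
  also have "\<dots> = trace (D ** X)"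
    using assms(1) by (simp add: matrix_mul_assoc tensor_mult unitary_mat_def tensor_one)
  finally show ?thesis .
qed

text \<open>The commutant of the tensor powers, written as the fixed points of conjugation. Its
  closure under sums, products and adjoints is then inherited from
  \<open>tensor_conj\<close>.\<close>

definition twirl_fixed :: "(complex^('n::finite^'k::finite)^('n^'k)) set"
  where "twirl_fixed = {X. \<forall>U. unitary_mat U \<longrightarrow> tensor_conj U X = X}"

lemma twirl_fixedD: "X \<in> twirl_fixed \<Longrightarrow> unitary_mat U \<Longrightarrow> tensor_conj U X = X"
  by (simp add: twirl_fixed_def)

lemma twirl_fixed_closed:
  "mat 1 \<in> twirl_fixed"
  "X \<in> twirl_fixed \<Longrightarrow> cscale c X \<in> twirl_fixed"
  "X \<in> twirl_fixed \<Longrightarrow> r *\<^sub>R X \<in> twirl_fixed"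
  "X \<in> twirl_fixed \<Longrightarrow> Y \<in> twirl_fixed \<Longrightarrow> X + Y \<in> twirl_fixed"
  "X \<in> twirl_fixed \<Longrightarrow> Y \<in> twirl_fixed \<Longrightarrow> X - Y \<in> twirl_fixed"
  "X \<in> twirl_fixed \<Longrightarrow> Y \<in> twirl_fixed \<Longrightarrow> X ** Y \<in> twirl_fixed"
  "X \<in> twirl_fixed \<Longrightarrow> dagger X \<in> twirl_fixed"
  "(\<And>x. x \<in> S \<Longrightarrow> M x \<in> twirl_fixed) \<Longrightarrow> (\<Sum>x\<in>S. M x) \<in> twirl_fixed"
  by (simp_all add: twirl_fixed_def tensor_conj_cscale tensor_conj_scaleR tensor_conj_add tensor_conj_diff tensor_conj_mult
      tensor_conj_dagger tensor_conj_one tensor_conj_sum)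

lemma twirl_fixed_zero: "0 \<in> twirl_fixed"
  using twirl_fixed_closed(8)[of "{}"] by simp

text \<open>Sends the basis vector v to v composed with p, that is, it permutes the tensor
  factors.\<close>

definition permutation_op :: "('k \<Rightarrow> 'k) \<Rightarrow> complex^('n::finite^'k::finite)^('n^'k)"
  where "permutation_op p = (\<chi> u v. if \<forall>l. u $ l = v $ p l then 1 else 0)"

text \<open>All factors of a tensor power are equal, so reindexing the product over the factors by p
  carries the permutation from one side of the tensor power to the other. For an involution p is its
  own inverse in this reindexing.\<close>

lemma permutation_op_fixed:
  assumes p: "\<And>l. p (p l) = l"
  shows "(permutation_op p :: complex^('n::finite^'k::finite)^('n^'k)) \<in> twirl_fixed"
proof -
  have e1: "(w = (\<chi> l. v $ p l)) \<longleftrightarrow> (\<forall>l. w $ l = v $ p l)" for v w :: "'n^'k" by (auto simp: vec_eq_iff)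
  have e2: "(w = (\<chi> l. u $ p l)) \<longleftrightarrow> (\<forall>l. u $ l = w $ p l)" for u w :: "'n^'k"
    by (auto simp: vec_eq_iff) (metis p)+
  have "tensor_power U ** permutation_op p = permutation_op p ** tensor_power U" for U :: "complex^'n^'n"
  proof -
    have "(tensor_power U ** permutation_op p) $ u $ v = (permutation_op p ** tensor_power U) $ u $ v" for u v :: "'n^'k"
    proof -
      have "(tensor_power U ** permutation_op p) $ u $ v = (\<Prod>l\<in>UNIV. U $ (u $ l) $ (v $ p l))"
        by (simp add: matrix_matrix_mult_def permutation_op_def e1[symmetric] if_distrib[of "(*) _"] cong: if_cong)
      also have "\<dots> = (\<Prod>l\<in>UNIV. U $ (u $ p l) $ (v $ l))"
        by (rule prod.reindex_bij_witness[of _ p p]) (simp_all add: p)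
      also have "\<dots> = (permutation_op p ** tensor_power U) $ u $ v"
        by (simp add: matrix_matrix_mult_def permutation_op_def e2[symmetric] if_distrib[of "\<lambda>x. x * _"] cong: if_cong)
      finally show ?thesis .
    qed
    then show ?thesis by (simp add: vec_eq_iff)
  qed
  then show ?thesis
    by (simp add: twirl_fixed_def tensor_conj_def)
      (simp add: matrix_mul_assoc[symmetric] tensor_mult unitary_mat_def tensor_one)
qed

text \<open>The trace is the squared Hilbert-Schmidt norm of D.\<close>

lemma trace_dagger_mult_eq_0:
  assumes "trace (dagger D ** D) = 0"
  shows "D = (0 :: complex^'n^'n)"
proof -
  have "(\<Sum>i\<in>UNIV. \<Sum>j\<in>UNIV. (cmod (D $ j $ i))\<^sup>2) = 0"
  proof -
    have "complex_of_real (\<Sum>i\<in>UNIV. \<Sum>j\<in>UNIV. (cmod (D $ j $ i))\<^sup>2) = trace (dagger D ** D)"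
      by (simp add: trace_def matrix_matrix_mult_def complex_norm_square mult.commute del: of_real_power)
    then show ?thesis using assms by (metis of_real_eq_0_iff)
  qed
  then show ?thesis by (simp add: sum_nonneg_eq_0_iff sum_nonneg vec_eq_iff)
qed

section \<open>Haar averages\<close>

lemma continuous_on_tensor_conj:
  "continuous_on S (\<lambda>U. tensor_conj U X :: complex^('n::finite^'k::finite)^('n^'k))"
proof -
  have "continuous_on S (\<lambda>U. \<chi> u v. tensor_conj U X $ u $ v)"
    unfolding tensor_conj_nth by (intro continuous_intros)
  then show ?thesis by simp
qed

lemma continuous_on_matrix_mult_left: "continuous_on S (\<lambda>V. (U :: complex^'n^'n) ** V)"
  unfolding matrix_matrix_mult_def by (intro continuous_intros)

text \<open>Every row of a unitary matrix has norm one, which bounds the entries; the defining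
  equations are continuous, so their solution set is closed. Compactness makes the twirl integrand
  bounded, hence integrable.\<close>

lemma compact_unitary: "compact {U :: complex^'n^'n. unitary_mat U}"
proof -
  have "norm (U $ i) \<le> real CARD('n)" if "unitary_mat U" for U :: "complex^'n^'n" and i
  proof -
    have "cmod (U $ i $ j) \<le> 1" for j
    proof -
      have "(\<Sum>j\<in>UNIV. U $ i $ j * cnj (U $ i $ j)) = (U ** dagger U) $ i $ i"
        by (simp add: matrix_matrix_mult_def)
      also have "\<dots> = 1" using that by (simp add: unitary_mat_def mat_def)
      finally have "complex_of_real (\<Sum>j\<in>UNIV. (cmod (U $ i $ j))\<^sup>2) = 1"
        by (simp add: complex_norm_square del: of_real_power)
      then have "(\<Sum>j\<in>UNIV. (cmod (U $ i $ j))\<^sup>2) = 1" by (metis of_real_eq_1_iff)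
      then have "(cmod (U $ i $ j))\<^sup>2 \<le> 1"
        by (metis UNIV_I finite_class.finite_UNIV member_le_sum zero_le_power2)
      then show ?thesis by (simp add: abs_square_le_1)
    qed
    then have "(\<Sum>j\<in>UNIV. norm (U $ i $ j)) \<le> (\<Sum>j\<in>(UNIV::'n set). 1)" by (intro sum_mono) auto
    then show ?thesis unfolding norm_vec_def[of "U $ i"]
      by (intro order_trans[OF L2_set_le_sum]) auto
  qed
  then have "norm U \<le> (\<Sum>i\<in>(UNIV::'n set). real CARD('n))" if "unitary_mat U" for U :: "complex^'n^'n"
    using that unfolding norm_vec_def[of U]
    by (intro order_trans[OF L2_set_le_sum] sum_mono) auto
  then have "bounded {U :: complex^'n^'n. unitary_mat U}"
    unfolding bounded_iff by blast
  moreover have "closed {U :: complex^'n^'n. unitary_mat U}"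
  proof -
    have "continuous_on UNIV (\<lambda>U :: complex^'n^'n. U ** dagger U)" "continuous_on UNIV (\<lambda>U :: complex^'n^'n. dagger U ** U)"
      unfolding matrix_matrix_mult_def dagger_nth by (intro continuous_intros)+
    then show ?thesis unfolding unitary_mat_def
      by (intro closed_Collect_conj closed_Collect_eq) (auto intro: continuous_on_const)
  qed
  ultimately show ?thesis by (simp add: compact_eq_bounded_closed)
qed

definition haar_twirl :: "(complex^'n::finite^'n) measure \<Rightarrow> complex^('n^'k::finite)^('n^'k) \<Rightarrow> complex^('n^'k)^('n^'k)"
  where "haar_twirl \<eta> X = (\<integral>V. tensor_conj V X \<partial>\<eta>)"

context
  fixes \<eta> :: "(complex^'n::finite^'n) measure"
  assumes haar: "haar_unitary \<eta>"
begin

interpretation prob_space \<eta> using haar by (simp add: haar_unitary_def)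

lemma haar_sets: "sets \<eta> = sets (restrict_space borel {U. unitary_mat U})"
  using haar by (simp add: haar_unitary_def)

lemma haar_space: "space \<eta> = {U. unitary_mat U}"
  using sets_eq_imp_space_eq[OF haar_sets] by (simp add: space_restrict_space)

lemma haar_tensor_conj_integrable: "integrable \<eta> (\<lambda>V. tensor_conj V X :: complex^('n::finite^'k::finite)^('n^'k))"
proof -
  have "compact ((\<lambda>V. tensor_conj V X :: complex^('n::finite^'k::finite)^('n^'k)) ` {U. unitary_mat U})"
    by (intro compact_continuous_image continuous_on_tensor_conj compact_unitary)
  then have "bounded ((\<lambda>V. tensor_conj V X :: complex^('n^'k::finite)^('n^'k)) ` {U. unitary_mat U})"
    by (rule compact_imp_bounded)
  then obtain B where "\<forall>Y\<in>(\<lambda>V. tensor_conj V X :: complex^('n^'k::finite)^('n^'k)) ` {U. unitary_mat U}. norm Y \<le> B"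
    unfolding bounded_iff by blast
  then have B: "norm (tensor_conj V X :: complex^('n^'k::finite)^('n^'k)) \<le> B" if "unitary_mat V" for V
    using that by simp
  have "(\<lambda>V. tensor_conj V X) \<in> borel_measurable (restrict_space borel {U. unitary_mat U})"
    by (intro borel_measurable_continuous_on_restrict continuous_on_tensor_conj)
  then have "(\<lambda>V. tensor_conj V X) \<in> borel_measurable \<eta>"
    using measurable_cong_sets[OF haar_sets refl] by blast
  then show ?thesis
    by (intro integrable_const_bound[where B = B]) (auto simp: haar_space B intro!: AE_I2)
qed

lemma haar_measurable_mult:
  assumes "unitary_mat U"
  shows "(\<lambda>V. U ** V) \<in> measurable \<eta> \<eta>"
proof -
  have "(\<lambda>V. U ** V) \<in> measurable (restrict_space borel {U. unitary_mat U}) borel"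
    by (intro borel_measurable_continuous_on_restrict continuous_on_matrix_mult_left)
  then have "(\<lambda>V. U ** V) \<in> measurable (restrict_space borel {U. unitary_mat U}) (restrict_space borel {U. unitary_mat U})"
    using assms by (intro measurable_restrict_space2) (auto simp: space_restrict_space unitary_mult)
  then show ?thesis
    using measurable_cong_sets[OF haar_sets haar_sets] by blast
qed

text \<open>\<open>haar_unitary\<close> states invariance for images of sets, whereas a change of
  variables needs preimages: the preimage under multiplication by U is the image under
  multiplication by the adjoint of U.\<close>

lemma haar_distr:
  assumes U: "unitary_mat U"
  shows "distr \<eta> \<eta> (\<lambda>V. U ** V) = \<eta>"
proof (rule measure_eqI)
  fix S assume "S \<in> sets (distr \<eta> \<eta> (\<lambda>V. U ** V))"
  then have S: "S \<in> sets \<eta>" by simp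
  then have sub: "S \<subseteq> {U. unitary_mat U}" using sets.sets_into_space haar_space by blast
  have "(\<lambda>V. U ** V) -` S \<inter> space \<eta> = (\<lambda>V. dagger U ** V) ` S"
  proof (intro equalityI subsetI)
    fix V assume "V \<in> (\<lambda>V. U ** V) -` S \<inter> space \<eta>"
    then show "V \<in> (\<lambda>V. dagger U ** V) ` S"
      using unitary_cancel(1)[OF U] by (metis IntD1 image_eqI vimageD)
  next
    fix V assume "V \<in> (\<lambda>V. dagger U ** V) ` S"
    then show "V \<in> (\<lambda>V. U ** V) -` S \<inter> space \<eta>"
      using sub U by (auto simp: haar_space unitary_cancel(2)[OF U] intro: unitary_mult unitary_dagger)
  qed
  then show "emeasure (distr \<eta> \<eta> (\<lambda>V. U ** V)) S = emeasure \<eta> S"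
    using haar S unitary_dagger[OF U]
    by (simp add: emeasure_distr[OF haar_measurable_mult[OF U]] haar_unitary_def)
qed simp

text \<open>Conjugation by U is bounded linear, so it passes under the integral, where left
  invariance of the measure absorbs U.\<close>

lemma haar_twirl_left_invariant:
  assumes U: "unitary_mat U"
  shows "tensor_conj U (haar_twirl \<eta> X) = haar_twirl \<eta> X"
proof -
  have "linear (tensor_conj U)"
    by (rule linearI) (simp_all add: tensor_conj_add tensor_conj_scaleR)
  then have bl: "bounded_linear (tensor_conj U)" by (simp add: linear_conv_bounded_linear)
  have "tensor_conj U (haar_twirl \<eta> X) = (\<integral>V. tensor_conj (U ** V) X \<partial>\<eta>)"
    unfolding haar_twirl_def tensor_conj_comp
    by (rule integral_bounded_linear[OF bl haar_tensor_conj_integrable, symmetric])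
  also have "\<dots> = (\<integral>V. tensor_conj V X \<partial>distr \<eta> \<eta> (\<lambda>V. U ** V))"
    using haar_tensor_conj_integrable
    by (intro integral_distr[symmetric] haar_measurable_mult[OF U] borel_measurable_integrable)
  also have "\<dots> = haar_twirl \<eta> X"
    by (simp only: haar_distr[OF U] haar_twirl_def)
  finally show ?thesis .
qed

text \<open>The trace against D passes under the integral and turns the integrand into a constant;
  the measure has total mass one.\<close>

lemma trace_haar_twirl:
  assumes D: "D \<in> twirl_fixed"
  shows "trace (D ** haar_twirl \<eta> X) = trace (D ** X)"
proof -
  have "linear (\<lambda>Y. trace (D ** Y))"
    by (rule linearI)
      (simp_all add: matrix_add_ldistrib cscale_of_real[symmetric] cscale_mult_right trace_def
        sum.distrib sum_distrib_left scaleR_conv_of_real)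
  then have bl: "bounded_linear (\<lambda>Y. trace (D ** Y))" by (simp add: linear_conv_bounded_linear)
  have "trace (D ** haar_twirl \<eta> X) = (\<integral>V. trace (D ** tensor_conj V X) \<partial>\<eta>)"
    unfolding haar_twirl_def by (rule integral_bounded_linear[OF bl haar_tensor_conj_integrable, symmetric])
  also have "\<dots> = (\<integral>V. trace (D ** X) \<partial>\<eta>)"
    by (intro Bochner_Integration.integral_cong) (auto simp: haar_space trace_tensor_conj twirl_fixedD[OF D])
  finally show ?thesis by (simp add: prob_space)
qed

end

section \<open>Arithmetic in characteristic two\<close>

declare add_bit_eq_xor [simp del] mult_bit_eq_and [simp del]

lemma bit_add_self [simp]: "(a :: bit) + a = 0"
  by (cases a) simp_all

lemma bits_add_self [simp]: "(a :: bit^'n) + a = 0"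
  by (simp add: vec_eq_iff)

lemma bits_add_self_left [simp]: "(a :: bit^'n) + (a + b) = b"
  by (simp add: add.assoc[symmetric])

lemma bits_eq_add_iff: "(u :: bit^'n) = v + a \<longleftrightarrow> v = u + a"
  by (auto simp: add.assoc)

section \<open>Pauli matrices\<close>

definition bdot :: "bit^'n \<Rightarrow> bit^'n \<Rightarrow> bit"
  where "bdot a b = (\<Sum>i\<in>UNIV. a $ i * b $ i)"

lemma bdot_commute: "bdot a b = bdot b a"
  by (simp add: bdot_def mult.commute)

lemma bdot_add_left: "bdot (a + b) c = bdot a c + bdot b c"
  and bdot_add_right: "bdot c (a + b) = bdot c a + bdot c b"
  by (simp_all add: bdot_def distrib_left distrib_right sum.distrib)

lemma bdot_zero [simp]: "bdot 0 a = 0" "bdot a 0 = 0"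
  by (simp_all add: bdot_def)

lemma bdot_axis: "bdot a (axis i 1) = a $ i"
proof -
  have "bdot a (axis i 1) = (\<Sum>j\<in>UNIV. if j = i then a $ j else 0)"
    unfolding bdot_def by (rule sum.cong) (auto simp: axis_def)
  then show ?thesis by simp
qed

lemma bdot_nonzero: "a \<noteq> 0 \<Longrightarrow> \<exists>b. bdot a b = 1"
  by (metis bdot_axis bit_not_zero_iff vec_eq_iff zero_index)

text \<open>The nontrivial additive character of the field with two elements.\<close>

definition bsgn :: "bit \<Rightarrow> complex"
  where "bsgn c = (if c = 1 then -1 else 1)"

lemma bsgn_simps [simp]: "bsgn 0 = 1" "bsgn 1 = -1" "cnj (bsgn c) = bsgn c"
    "bsgn c * bsgn c = 1" "bsgn c * (bsgn c * z) = z" "cmod (bsgn c) = 1" "bsgn c \<noteq> 0"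
  by (simp_all add: bsgn_def)

lemma bsgn_add: "bsgn (a + b) = bsgn a * bsgn b"
  by (cases a; cases b) simp_all

lemma bsgn_sum: "bsgn (\<Sum>i\<in>S. h i) = (\<Prod>i\<in>S. bsgn (h i))"
  by (induction S rule: infinite_finite_induct) (simp_all add: bsgn_add)

text \<open>Orthogonality of characters: for w \<noteq> 0, translation by a c with w . c = 1
  permutes the summands and reverses all signs.\<close>

lemma sum_bsgn_bdot:
  fixes w :: "bit^'n"
  shows "(\<Sum>b\<in>UNIV. bsgn (bdot b w)) = (if w = 0 then of_nat CARD(bit^'n) else 0)"
proof (cases "w = 0")
  case False
  then obtain c where c: "bdot w c = 1" using bdot_nonzero by blast
  have "(\<Sum>b\<in>UNIV. bsgn (bdot b w)) = (\<Sum>b\<in>UNIV. bsgn (bdot (b + c) w))"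
    by (rule sum.reindex_bij_witness[of _ "\<lambda>b. b + c" "\<lambda>b. b + c"]) (simp_all add: add.assoc)
  also have "\<dots> = - (\<Sum>b\<in>UNIV. bsgn (bdot b w))"
    using c by (simp add: bdot_add_left bsgn_add bdot_commute[of c] sum_negf)
  finally have "2 * (\<Sum>b\<in>UNIV. bsgn (bdot b w)) = 0" by (simp only: mult_2 add.right_inverse) simp
  then show ?thesis using False by simp
qed simp

lemma prod_if_zero:
  fixes f :: "'a \<Rightarrow> 'b::comm_semiring_1"
  assumes "finite S"
  shows "(\<Prod>i\<in>S. if P i then f i else 0) = (if \<forall>i\<in>S. P i then \<Prod>i\<in>S. f i else 0)"
  using assms by (induction S rule: finite_induct) auto

text \<open>In each factor Z acts before X, so the sign is read off from the column index v, and the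
  basis vector v is then moved to v + a.\<close>

lemma pauli_D_nth:
  "pauli_D a b $ u $ v = (if u = v + a then bsgn (bdot b v) else 0)"
proof -
  have "(bit_power pauli_X x ** bit_power pauli_Z z) $ s $ t = (if s = t + x then bsgn (z * t) else 0)"
    for x z s t
    by (cases x; cases z; cases s; cases t)
      (simp_all add: matrix_matrix_mult_def UNIV_bit bit_power_def pauli_X_def pauli_Z_def mat_def del: bit_not_zero_iff)
  then show ?thesis
    by (simp add: pauli_D_def prod_if_zero vec_eq_iff bdot_def bsgn_sum)
qed

type_synonym 'm pauli_label = "'m bits \<times> 'm bits"

definition pauli :: "'m::finite pauli_label \<Rightarrow> 'm qop"
  where "pauli P = pauli_D (fst P) (snd P)"

text \<open>The symplectic form on labels; it is 0 or 1 according to whether the Pauli matrices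
  commute or anticommute (\<open>pauli_commute\<close>).\<close>

definition sympl :: "'m::finite pauli_label \<Rightarrow> 'm pauli_label \<Rightarrow> bit"
  where "sympl P Q = bdot (fst P) (snd Q) + bdot (snd P) (fst Q)"

lemma pauli_nth: "pauli P $ u $ v = (if u = v + fst P then bsgn (bdot (snd P) v) else 0)"
  by (simp add: pauli_def pauli_D_nth)

lemma label_add_self [simp]: "(P :: 'm::finite pauli_label) + P = 0"
  and label_add_self_left [simp]: "(P :: 'm::finite pauli_label) + (P + Q) = Q"
  by (simp_all add: prod_eq_iff)

lemma label_add_eq_0: "(P :: 'm::finite pauli_label) + Q = 0 \<longleftrightarrow> P = Q"
  by (metis add.right_neutral label_add_self label_add_self_left)

lemma sympl_commute: "sympl P Q = sympl Q P"
  by (simp add: sympl_def bdot_commute add.commute)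

lemma sympl_self [simp]: "sympl P P = 0"
  by (simp add: sympl_def bdot_commute)

lemma sympl_add_left: "sympl (P + Q) R = sympl P R + sympl Q R"
  and sympl_add_right: "sympl R (P + Q) = sympl R P + sympl R Q"
  by (simp_all add: sympl_def bdot_add_left bdot_add_right algebra_simps)

lemma sympl_zero [simp]: "sympl 0 P = 0" "sympl P 0 = 0"
  by (simp_all add: sympl_def)

lemma sympl_nondegenerate:
  assumes "P \<noteq> 0"
  shows "\<exists>R. sympl P R = 1"
proof (cases "fst P = 0")
  case True
  then have "snd P \<noteq> 0" using assms by (simp add: prod_eq_iff)
  then obtain c where "bdot (snd P) c = 1" using bdot_nonzero by blast
  then have "sympl P (c, 0) = 1" by (simp add: sympl_def)
  then show ?thesis ..
next
  case False
  then obtain c where "bdot (fst P) c = 1" using bdot_nonzero by blast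
  then have "sympl P (0, c) = 1" by (simp add: sympl_def)
  then show ?thesis ..
qed

lemma pauli_zero [simp]: "pauli 0 = mat 1"
  by (simp add: vec_eq_iff pauli_nth mat_def)

text \<open>The sign is the cost of moving the Z part of P past the X part of Q.\<close>

lemma pauli_mult: "pauli P ** pauli Q = cscale (bsgn (bdot (snd P) (fst Q))) (pauli (P + Q))"
proof -
  have "(pauli P ** pauli Q) $ u $ v = (\<Sum>w\<in>UNIV. if w = v + fst Q then
      (if u = v + fst Q + fst P then bsgn (bdot (snd P) (v + fst Q)) * bsgn (bdot (snd Q) v) else 0) else 0)" for u v
    unfolding matrix_matrix_mult_def vec_lambda_beta by (rule sum.cong) (auto simp: pauli_nth)
  then have "(pauli P ** pauli Q) $ u $ v = cscale (bsgn (bdot (snd P) (fst Q))) (pauli (P + Q)) $ u $ v" for u v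
    by (simp add: pauli_nth bdot_add_left bdot_add_right bsgn_add add_ac)
  then show ?thesis by (simp add: vec_eq_iff)
qed

lemma pauli_dagger: "dagger (pauli P) = cscale (bsgn (bdot (fst P) (snd P))) (pauli P)"
proof -
  have "dagger (pauli P) $ u $ v = cscale (bsgn (bdot (fst P) (snd P))) (pauli P) $ u $ v" for u v
    by (auto simp: pauli_nth bits_eq_add_iff[of u] bdot_add_right bsgn_add bdot_commute)
  then show ?thesis by (simp add: vec_eq_iff)
qed

lemma unitary_pauli: "unitary_mat (pauli P)"
  by (simp add: unitary_mat_def pauli_dagger cscale_mult_left cscale_mult_right pauli_mult bdot_commute)

lemma pauli_commute: "pauli P ** pauli Q = cscale (bsgn (sympl P Q)) (pauli Q ** pauli P)"
  by (simp add: pauli_mult sympl_def bsgn_add bdot_commute add.commute mult_ac)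

lemma pauli_conj: "pauli P ** pauli Q ** dagger (pauli P) = cscale (bsgn (sympl P Q)) (pauli Q)"
  by (simp add: pauli_commute[of P Q] cscale_mult_left unitary_cancel[OF unitary_pauli])

text \<open>The completeness relation of the Pauli basis. The entries force a = u + v, and what is
  left is a character sum over the Z part b. Both the expansion in Pauli tensors and the swap
  identity rest on it.\<close>

lemma pauli_complete:
  fixes u v x y :: "'m::finite bits"
  shows "(\<Sum>P\<in>UNIV. pauli P $ u $ v * cnj (pauli P $ x $ y)) =
    (if u = x \<and> v = y then of_nat CARD('m bits) else 0)"
proof -
  have "(\<Sum>P\<in>UNIV. pauli P $ u $ v * cnj (pauli P $ x $ y)) =
    (\<Sum>a\<in>UNIV. \<Sum>b\<in>UNIV. (if u = v + a \<and> x = y + a then bsgn (bdot b (v + y)) else 0))"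
    unfolding sum.cartesian_product UNIV_Times_UNIV
    by (auto intro!: sum.cong simp: pauli_nth bdot_add_right bsgn_add)
  also have "\<dots> = (\<Sum>a\<in>UNIV. if a = u + v then (if x = y + a then if v + y = 0 then of_nat CARD('m bits) else 0 else 0) else 0)"
  proof (intro sum.cong refl)
    fix a :: "'m bits"
    have "u = v + a \<longleftrightarrow> a = u + v" by (metis bits_eq_add_iff add.commute)
    then show "(\<Sum>b\<in>UNIV. (if u = v + a \<and> x = y + a then bsgn (bdot b (v + y)) else 0)) =
       (if a = u + v then (if x = y + a then if v + y = 0 then of_nat CARD('m bits) else 0 else 0) else 0)"
      by (simp add: sum_bsgn_bdot)
  qed
  also have "\<dots> = (if u = x \<and> v = y then of_nat CARD('m bits) else 0)"
  proof -
    have "v + y = 0 \<longleftrightarrow> v = y" by (metis add.right_neutral bits_add_self bits_add_self_left)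
    moreover have "x = y + (u + y) \<longleftrightarrow> u = x" by (metis add.commute bits_add_self_left)
    ultimately show ?thesis by auto
  qed
  finally show ?thesis .
qed

text \<open>The coefficients are Hilbert-Schmidt inner products divided by the squared norm of a
  Pauli tensor; completeness is applied in each factor separately.\<close>

lemma tensor_pauli_expansion:
  fixes X :: "complex^('m::finite bits^'k::finite)^('m bits^'k)"
  shows "\<exists>c. X = (\<Sum>f\<in>(UNIV :: ('k \<Rightarrow> 'm pauli_label) set). cscale (c f) (tensor (\<lambda>i. pauli (f i))))"
proof -
  let ?N = "of_nat CARD('m bits) :: complex"
  define c where "c f = (\<Sum>x\<in>UNIV. \<Sum>y\<in>UNIV. X $ x $ y * cnj (tensor (\<lambda>i. pauli (f i)) $ x $ y)) / ?N ^ CARD('k)"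
    for f :: "'k \<Rightarrow> 'm pauli_label"
  have "(\<Sum>f\<in>UNIV. cscale (c f) (tensor (\<lambda>i. pauli (f i)))) $ u $ v = X $ u $ v" for u v :: "'m bits^'k"
  proof -
    have o: "(\<Sum>f\<in>(UNIV :: ('k \<Rightarrow> 'm pauli_label) set). \<Prod>i\<in>UNIV. pauli (f i) $ (u $ i) $ (v $ i) * cnj (pauli (f i) $ (x $ i) $ (y $ i)))
       = (if u = x \<and> v = y then ?N ^ CARD('k) else 0)" for x y
    proof -
      have "(\<Sum>f\<in>(UNIV :: ('k \<Rightarrow> 'm pauli_label) set). \<Prod>i\<in>UNIV. pauli (f i) $ (u $ i) $ (v $ i) * cnj (pauli (f i) $ (x $ i) $ (y $ i)))
        = (\<Prod>i\<in>UNIV. \<Sum>P\<in>UNIV. pauli P $ (u $ i) $ (v $ i) * cnj (pauli P $ (x $ i) $ (y $ i)))"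
        by (simp add: prod_sum_PiE PiE_UNIV_domain)
      also have "\<dots> = (if \<forall>i. u $ i = x $ i \<and> v $ i = y $ i then ?N ^ CARD('k) else 0)"
        unfolding pauli_complete by (subst prod_if_zero) auto
      finally show ?thesis by (simp add: vec_eq_iff all_conj_distrib)
    qed
    have "(\<Sum>f\<in>UNIV. cscale (c f) (tensor (\<lambda>i. pauli (f i)))) $ u $ v =
      (\<Sum>f\<in>UNIV. \<Sum>x\<in>UNIV. \<Sum>y\<in>UNIV. X $ x $ y / ?N ^ CARD('k) *
          (\<Prod>i\<in>UNIV. pauli (f i) $ (u $ i) $ (v $ i) * cnj (pauli (f i) $ (x $ i) $ (y $ i))))"
      unfolding sum_component cscale_nth c_def sum_divide_distrib sum_distrib_right
      by (intro sum.cong refl) (simp add: prod.distrib)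
    also have "\<dots> = (\<Sum>x\<in>UNIV. \<Sum>y\<in>UNIV. X $ x $ y / ?N ^ CARD('k) *
        (\<Sum>f\<in>UNIV. \<Prod>i\<in>UNIV. pauli (f i) $ (u $ i) $ (v $ i) * cnj (pauli (f i) $ (x $ i) $ (y $ i))))"
      unfolding sum_distrib_left
      by (subst sum.swap, rule sum.cong[OF refl], rule sum.swap)
    also have "\<dots> = (\<Sum>x\<in>UNIV. \<Sum>y\<in>UNIV. if y = v then if x = u then X $ u $ v else 0 else 0)"
      unfolding o by (intro sum.cong) auto
    also have "\<dots> = X $ u $ v" by simp
    finally show ?thesis .
  qed
  then show ?thesis by (intro exI[of _ c]) (simp add: vec_eq_iff)
qed

text \<open>Schur's lemma for the Pauli matrices, done by hand: labels (0, b) kill the off-diagonal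
  entries and labels (u, 0) make the diagonal constant.\<close>

lemma commutes_with_paulis_scalar:
  fixes M :: "'m::finite qop"
  assumes comm: "\<And>P. pauli P ** M = M ** pauli P"
  shows "\<exists>c. M = cscale c (mat 1)"
proof -
  have l: "(pauli P ** M) $ u $ v = bsgn (bdot (snd P) (u + fst P)) * M $ (u + fst P) $ v" for P u v
  proof -
    have "(pauli P ** M) $ u $ v = (\<Sum>w\<in>UNIV. if w = u + fst P then bsgn (bdot (snd P) w) * M $ w $ v else 0)"
      unfolding matrix_matrix_mult_def
      by (simp add: pauli_nth bits_eq_add_iff[of u] if_distrib[of "\<lambda>x. x * _"] cong: if_cong)
    then show ?thesis by simp
  qed
  have r: "(M ** pauli P) $ u $ v = M $ u $ (v + fst P) * bsgn (bdot (snd P) v)" for P u v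
    unfolding matrix_matrix_mult_def
    by (simp add: pauli_nth if_distrib cong: if_cong)
  have diag: "M $ u $ v = 0" if "u \<noteq> v" for u v
  proof -
    have "u + v \<noteq> 0" using that by (metis add.right_neutral bits_add_self_left)
    then obtain b where b: "bdot (u + v) b = 1" using bdot_nonzero by blast
    have "bsgn (bdot b u) * M $ u $ v = M $ u $ v * bsgn (bdot b v)"
      using l[of "(0, b)" u v] r[of "(0, b)" u v] comm[of "(0, b)"]
      by (metis add.right_neutral fst_conv snd_conv)
    moreover have "bsgn (bdot b u) = - bsgn (bdot b v)"
      using b unfolding bdot_commute[of "u + v" b] bdot_add_right
      by (cases "bdot b u"; cases "bdot b v") simp_all
    ultimately show ?thesis by simp
  qed
  have const: "M $ u $ u = M $ 0 $ 0" for u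
    using l[of "(u, 0)" u 0] r[of "(u, 0)" u 0] comm[of "(u, 0)"] by simp
  have "M $ u $ v = cscale (M $ 0 $ 0) (mat 1) $ u $ v" for u v
    using diag[of u v] const[of u] by (cases "u = v") (simp_all add: mat_def)
  then have "M = cscale (M $ 0 $ 0) (mat 1)"
    unfolding vec_eq_iff by blast
  then show ?thesis ..
qed

text \<open>The adjoint in factor j cancels the phase that conjugation produces in factor i.\<close>

definition pair_tensor :: "'k::finite \<Rightarrow> 'k \<Rightarrow> 'm::finite pauli_label \<Rightarrow> complex^('m bits^'k)^('m bits^'k)"
  where "pair_tensor i j P = tensor (\<lambda>l. if l = i then pauli P else if l = j then dagger (pauli P) else mat 1)"

text \<open>By completeness the sum is the dimension times the swap of factors i and j.\<close>

lemma sum_pair_tensor_fixed: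
  assumes ij: "(i :: 'k::finite) \<noteq> j"
  shows "(\<Sum>P\<in>UNIV. pair_tensor i j P :: complex^('m::finite bits^'k)^('m bits^'k)) \<in> twirl_fixed"
proof -
  let ?p = "(id(i := j, j := i)) :: 'k \<Rightarrow> 'k"
  have split: "(\<Prod>l\<in>UNIV. h l) = h i * h j * (\<Prod>l\<in>UNIV - {i, j}. h l)" for h :: "'k \<Rightarrow> complex"
  proof -
    have "(\<Prod>l\<in>UNIV. h l) = (\<Prod>l\<in>{i, j}. h l) * (\<Prod>l\<in>UNIV - {i, j}. h l)"
      by (subst prod.subset_diff[of "{i, j}"]) (auto simp: mult.commute)
    then show ?thesis using ij by simp
  qed
  have "(\<Sum>P\<in>UNIV. pair_tensor i j P) = cscale (of_nat CARD('m bits)) (permutation_op ?p :: complex^('m bits^'k)^('m bits^'k))"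
  proof -
    have "(\<Sum>P\<in>UNIV. pair_tensor i j P) $ u $ v = cscale (of_nat CARD('m bits)) (permutation_op ?p) $ u $ v"
      for u v :: "'m bits^'k"
    proof -
      have "(\<Sum>P\<in>UNIV. pair_tensor i j P) $ u $ v =
         (\<Sum>P\<in>UNIV. pauli P $ (u $ i) $ (v $ i) * cnj (pauli P $ (v $ j) $ (u $ j)) *
            (\<Prod>l\<in>UNIV - {i, j}. if u $ l = v $ l then 1 else 0))"
        using ij by (simp add: pair_tensor_def split mat_def)
      also have "\<dots> = (if u $ i = v $ j \<and> v $ i = u $ j then of_nat CARD('m bits) else 0) *
            (if \<forall>l\<in>UNIV - {i, j}. u $ l = v $ l then 1 else 0)"
        by (simp only: sum_distrib_right[symmetric] pauli_complete prod_if_zero[OF finite] prod.neutral_const)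
      also have "\<dots> = (if \<forall>l. u $ l = v $ ?p l then of_nat CARD('m bits) else 0)"
      proof -
        have "(\<forall>l. u $ l = v $ ?p l) \<longleftrightarrow> (u $ i = v $ j \<and> v $ i = u $ j) \<and> (\<forall>l\<in>UNIV - {i, j}. u $ l = v $ l)"
          using ij by (auto simp: fun_upd_def split: if_splits)
        then show ?thesis by simp
      qed
      finally show ?thesis by (simp add: permutation_op_def)
    qed
    then show ?thesis by (simp add: vec_eq_iff)
  qed
  moreover have "(permutation_op ?p :: complex^('m bits^'k)^('m bits^'k)) \<in> twirl_fixed"
    by (rule permutation_op_fixed) (use ij in auto)
  ultimately show ?thesis by (simp add: twirl_fixed_closed)
qed

section \<open>A criterion for unitary designs\<close>

definition ensemble_twirl :: "'i set \<Rightarrow> ('i \<Rightarrow> complex^'n::finite^'n) \<Rightarrow>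
    complex^('n^'k::finite)^('n^'k) \<Rightarrow> complex^('n^'k)^('n^'k)"
  where "ensemble_twirl I U X = (\<Sum>i\<in>I. (1 / real (card I)) *\<^sub>R tensor_conj (U i) X)"

lemma ensemble_twirl_cscale: "ensemble_twirl I U (cscale c X) = cscale c (ensemble_twirl I U X)"
  by (simp add: ensemble_twirl_def cscale_sum tensor_conj_cscale cscale_of_real[symmetric] mult.commute)

lemma ensemble_twirl_sum: "ensemble_twirl I U (\<Sum>x\<in>S. M x) = (\<Sum>x\<in>S. ensemble_twirl I U (M x))"
  by (simp add: ensemble_twirl_def tensor_conj_sum scaleR_sum_right sum.swap[of _ S])

lemma ensemble_twirl_const:
  assumes "finite I" "I \<noteq> {}" "\<And>i. i \<in> I \<Longrightarrow> tensor_conj (U i) X = Y"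
  shows "ensemble_twirl I U X = Y"
  using assms by (simp add: ensemble_twirl_def sum_constant_scaleR del: sum_constant)

text \<open>The difference \<open>D\<close> of the two twirls of \<open>X\<close> lies in the commutant: the Haar twirl is its own
  ensemble twirl. Both twirls preserve \<open>tr (D\<^sup>\<dagger> X)\<close>, so \<open>tr (D\<^sup>\<dagger> D) = 0\<close>.\<close>

lemma uniform_design_criterion:
  fixes \<eta> :: "(complex^'n::finite^'n) measure" and U :: "'i \<Rightarrow> complex^'n^'n"
  assumes haar: "haar_unitary \<eta>" and I: "finite I" "I \<noteq> {}" "\<And>i. i \<in> I \<Longrightarrow> unitary_mat (U i)"
    and fixed: "\<And>X :: complex^('n^'k::finite)^('n^'k). ensemble_twirl I U X \<in> twirl_fixed"
  shows "uniform_unitary_design TYPE('k) \<eta> I U"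
proof -
  have "ensemble_twirl I U X = haar_twirl \<eta> X" for X :: "complex^('n^'k)^('n^'k)"
  proof -
    have "ensemble_twirl I U (haar_twirl \<eta> X) = haar_twirl \<eta> X"
      using I by (intro ensemble_twirl_const haar_twirl_left_invariant[OF haar]) auto
    then have H: "haar_twirl \<eta> X \<in> twirl_fixed" using fixed by metis
    define D where "D = haar_twirl \<eta> X - ensemble_twirl I U X"
    have D: "dagger D \<in> twirl_fixed" unfolding D_def by (intro twirl_fixed_closed H fixed)
    have "trace (dagger D ** ensemble_twirl I U X) = (\<Sum>i\<in>I. (1 / real (card I)) *\<^sub>R trace (dagger D ** tensor_conj (U i) X))"
      by (simp add: ensemble_twirl_def matrix_mult_sum_right cscale_of_real[symmetric] cscale_mult_right)
        (simp add: trace_def sum_distrib_left scaleR_conv_of_real sum.swap[of _ I])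
    also have "\<dots> = (\<Sum>i\<in>I. (1 / real (card I)) *\<^sub>R trace (dagger D ** X))"
      using I(3) by (simp add: trace_tensor_conj twirl_fixedD[OF D])
    also have "\<dots> = trace (dagger D ** X)"
      using I(1,2) by (simp add: sum_constant_scaleR del: sum_constant)
    finally have E: "trace (dagger D ** ensemble_twirl I U X) = trace (dagger D ** X)" .
    have "trace (dagger D ** D) = trace (dagger D ** haar_twirl \<eta> X) - trace (dagger D ** ensemble_twirl I U X)"
      by (subst (2) D_def) (simp add: matrix_mult_diff_right trace_sub)
    then have "trace (dagger D ** D) = 0" by (simp add: E trace_haar_twirl[OF haar D])
    then have "D = 0" by (rule trace_dagger_mult_eq_0)
    then show ?thesis by (simp add: D_def)
  qed
  then show ?thesis
    using I unfolding uniform_unitary_design_def unitary_design_def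
    by (simp add: ensemble_twirl_def haar_twirl_def tensor_conj_def)
qed

text \<open>Pauli tensors span all operators, and the commutant is a linear subspace.\<close>

lemma ensemble_twirl_fixedI:
  fixes X :: "complex^('m::finite bits^'k::finite)^('m bits^'k)"
  assumes "\<And>f. (ensemble_twirl I U (tensor (\<lambda>i. pauli (f i))) :: complex^('m bits^'k)^('m bits^'k)) \<in> twirl_fixed"
  shows "ensemble_twirl I U X \<in> twirl_fixed"
proof -
  obtain c where "X = (\<Sum>f\<in>UNIV. cscale (c f) (tensor (\<lambda>i. pauli (f i))))"
    using tensor_pauli_expansion by blast
  then show ?thesis
    using assms by (simp add: ensemble_twirl_sum ensemble_twirl_cscale twirl_fixed_closed)
qed

section \<open>Transvections\<close>

text \<open>The symplectic transvection along V, which adds (V, P) V to P.\<close>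

definition transvect :: "'m::finite pauli_label \<Rightarrow> 'm pauli_label \<Rightarrow> 'm pauli_label"
  where "transvect V P = (if sympl V P = 1 then V + P else P)"

lemma transvect_sympl: "sympl (transvect V P) (transvect V Q) = sympl P Q"
  by (cases "sympl V P"; cases "sympl V Q")
    (simp_all add: transvect_def sympl_add_left sympl_add_right sympl_commute[of _ V])

lemma transvect_transvect [simp]: "transvect V (transvect V P) = P"
  by (simp add: transvect_def sympl_add_right)

lemma transvect_eq_iff [simp]: "transvect V P = transvect V Q \<longleftrightarrow> P = Q"
  by (metis transvect_transvect)

lemma transvect_simps [simp]: "transvect 0 P = P" "transvect V 0 = 0"
  by (simp_all add: transvect_def)

lemma transvect_eq_0_iff [simp]: "transvect V P = 0 \<longleftrightarrow> P = 0"
  by (metis transvect_simps(2) transvect_transvect)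

text \<open>The direction P + Q exchanges P and Q when they anticommute, and it fixes every R that
  has the same product with both. All transitivity proofs below are built from this move.\<close>

lemma transvect_sum:
  "sympl P Q = 1 \<Longrightarrow> transvect (P + Q) P = Q"
  "sympl P R = sympl Q R \<Longrightarrow> transvect (P + Q) R = R"
  by (auto simp: transvect_def sympl_add_left sympl_commute[of Q P] add.commute[of P Q] add.assoc)

text \<open>Take x and y on which the two functionals take the value 1; one of x, y, x + y works for
  both.\<close>

lemma sympl_separate:
  assumes "P \<noteq> 0" "Q \<noteq> 0"
  shows "\<exists>R. sympl P R = 1 \<and> sympl Q R = 1"
proof -
  obtain x y where "sympl P x = 1" "sympl Q y = 1" using sympl_nondegenerate assms by metis
  then show ?thesis
    by (cases "sympl Q x"; cases "sympl P y") (metis sympl_add_right add.left_neutral add.right_neutral)+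
qed

text \<open>The functional of Q is neither zero nor that of P. Over the field with two elements it
  is then no multiple of the latter, so it does not vanish on the kernel of the latter.\<close>

lemma sympl_separate_kernel:
  assumes "Q \<noteq> 0" "Q \<noteq> P"
  shows "\<exists>R. sympl P R = 0 \<and> sympl Q R = 1"
proof -
  have "P + Q \<noteq> 0" using assms by (simp add: label_add_eq_0)
  then obtain x y where "sympl Q x = 1" "sympl (P + Q) y = 1" using sympl_nondegenerate assms by metis
  then show ?thesis
    by (cases "sympl P x"; cases "sympl P y"; cases "sympl Q y")
      (metis sympl_add_right sympl_add_left add.left_neutral add.right_neutral bit_add_self zero_neq_one)+
qed

text \<open>The argument of \<open>sympl_separate\<close>, carried out inside the kernel of the
  functional of P.\<close>

lemma sympl_separate_kernel_two:
  assumes "Q \<noteq> 0" "Q \<noteq> P" "Q' \<noteq> 0" "Q' \<noteq> P"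
  shows "\<exists>R. sympl P R = 0 \<and> sympl Q R = 1 \<and> sympl Q' R = 1"
proof -
  obtain x y where "sympl P x = 0" "sympl Q x = 1" "sympl P y = 0" "sympl Q' y = 1"
    using sympl_separate_kernel assms by metis
  then show ?thesis
    by (cases "sympl Q' x"; cases "sympl Q y") (metis sympl_add_right add.left_neutral add.right_neutral)+
qed

text \<open>A label R that anticommutes with both P and P' serves as an intermediate stop.\<close>

lemma transvect_transitive:
  assumes "P \<noteq> 0" "P' \<noteq> 0"
  shows "\<exists>V W. transvect V (transvect W P) = P'"
proof -
  obtain R where R: "sympl P R = 1" "sympl P' R = 1" using sympl_separate[OF assms] by blast
  then have "transvect (R + P') (transvect (P + R) P) = P'"
    by (simp add: transvect_sum sympl_commute)
  then show ?thesis by blast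
qed

text \<open>If Q and Q' anticommute, one transvection along Q + Q' does it, and equal products with
  P mean that P stays fixed. Otherwise the path goes through an R that anticommutes with Q and Q'
  and has their product with P.\<close>

lemma transvect_transitive_stabilizer:
  assumes "Q \<noteq> 0" "Q \<noteq> P" "Q' \<noteq> 0" "Q' \<noteq> P" and c: "sympl P Q = sympl P Q'"
  shows "\<exists>V W. transvect V (transvect W P) = P \<and> transvect V (transvect W Q) = Q'"
proof (cases "sympl Q Q' = 1")
  case True
  then have "transvect (Q + Q') P = P" "transvect (Q + Q') Q = Q'"
    using c by (simp_all add: transvect_sum sympl_commute[of _ P])
  then show ?thesis by (metis transvect_simps(1))
next
  case orth: False
  obtain R where R: "sympl P R = sympl P Q" "sympl Q R = 1" "sympl Q' R = 1"
  proof (cases "sympl P Q = 0")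
    case True
    then show ?thesis using that sympl_separate_kernel_two[OF assms(1-4)] by metis
  next
    case False
    then have "sympl Q P = 1" "sympl Q' P = 1"
      using c by (simp_all add: sympl_commute[of _ P])
    \<comment> \<open>Here P anticommutes with Q and Q', while Q and Q' commute, so R = P + Q has
      all three required products.\<close>
    then show ?thesis
      using orth by (intro that[of "P + Q"]) (simp_all add: sympl_add_right sympl_commute[of Q' Q])
  qed
  have "transvect (Q + R) P = P" "transvect (Q + R) Q = R"
    using R by (simp_all add: transvect_sum sympl_commute[of _ P])
  moreover have "transvect (R + Q') P = P" "transvect (R + Q') R = Q'"
    using R c by (simp_all add: transvect_sum sympl_commute[of _ P] sympl_commute[of R])
  ultimately show ?thesis by metis
qed

text \<open>Witt's theorem for pairs: carry P to P', then move the image of Q to Q' within the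
  stabilizer of P'.\<close>

lemma transvect_invariant_pair:
  assumes inv: "\<And>V P Q. h (transvect V P) (transvect V Q) = h P Q"
    and P: "P \<noteq> 0" "Q \<noteq> 0" "Q \<noteq> P" and P': "P' \<noteq> 0" "Q' \<noteq> 0" "Q' \<noteq> P'"
    and sympl: "sympl P Q = sympl P' Q'"
  shows "h P Q = h P' Q'"
proof -
  obtain V W where VW: "transvect V (transvect W P) = P'" using transvect_transitive P P' by blast
  define Q1 where "Q1 = transvect V (transvect W Q)"
  have Q1: "Q1 \<noteq> 0" "Q1 \<noteq> P'" "sympl P' Q1 = sympl P' Q'"
    using P by (simp_all add: Q1_def VW[symmetric] transvect_sympl sympl)
  obtain V' W' where "transvect V' (transvect W' P') = P'" "transvect V' (transvect W' Q1) = Q'"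
    using transvect_transitive_stabilizer[OF Q1(1,2) P'(2,3) Q1(3)] by blast
  then show ?thesis using inv VW Q1_def by metis
qed

section \<open>The Clifford group\<close>

text \<open>Phases as fourth roots of unity are visibly closed under products, which avoids
  bookkeeping of exponents modulo 4.\<close>

lemma phase_iff: "(z :: complex) ^ 4 = 1 \<longleftrightarrow> (\<exists>\<kappa><4. z = \<i> ^ \<kappa>)"
proof
  assume "z ^ 4 = 1"
  then have "(z - 1) * (z + 1) * (z - \<i>) * (z + \<i>) = 0"
    by (simp add: algebra_simps power4_eq_xxxx)
  then have "z = \<i> ^ 0 \<or> z = \<i> ^ 1 \<or> z = \<i> ^ 2 \<or> z = \<i> ^ 3"
    by (auto simp: eq_neg_iff_add_eq_0 power3_eq_cube)
  then show "\<exists>\<kappa><4. z = \<i> ^ \<kappa>"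
    by (elim disjE) (rule exI[of _ 0] exI[of _ 1] exI[of _ 2] exI[of _ 3]; simp; fail)+
next
  assume "\<exists>\<kappa><4. z = \<i> ^ \<kappa>"
  then obtain k where "z = \<i> ^ k" by blast
  then have "z ^ 4 = (\<i> ^ 4) ^ k" by (simp only: power_mult[symmetric] mult.commute)
  then show "z ^ 4 = 1" by (simp add: power4_eq_xxxx)
qed

lemma phase_cmod: "(z :: complex) ^ 4 = 1 \<Longrightarrow> cmod z = 1"
  by (auto simp: phase_iff norm_power)

lemma HW_iff: "M \<in> HW \<longleftrightarrow> (\<exists>z P. z ^ 4 = 1 \<and> M = cscale z (pauli P))"
  unfolding HW_def phase_iff pauli_def by force

lemma Cliff_iff: "g \<in> Cliff \<longleftrightarrow>
    unitary_mat g \<and> (\<forall>P. \<exists>z Q. z ^ 4 = 1 \<and> g ** pauli P ** dagger g = cscale z (pauli Q))"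
  unfolding Cliff_def HW_iff by (auto simp: pauli_def)

lemma Cliff_unitary: "g \<in> Cliff \<Longrightarrow> unitary_mat g"
  by (simp add: Cliff_def)

lemma Cliff_mult:
  assumes g: "g \<in> Cliff" and h: "h \<in> Cliff"
  shows "g ** h \<in> Cliff"
proof -
  have "\<exists>z Q. z ^ 4 = 1 \<and> g ** h ** pauli P ** dagger (g ** h) = cscale z (pauli Q)" for P
  proof -
    obtain z Q where z: "z ^ 4 = 1" "h ** pauli P ** dagger h = cscale z (pauli Q)"
      using h unfolding Cliff_iff by blast
    obtain w R where w: "w ^ 4 = 1" "g ** pauli Q ** dagger g = cscale w (pauli R)"
      using g unfolding Cliff_iff by blast
    have "g ** h ** pauli P ** dagger (g ** h) = g ** (h ** pauli P ** dagger h) ** dagger g"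
      by (simp add: dagger_mult matrix_mul_assoc)
    then have "g ** h ** pauli P ** dagger (g ** h) = cscale (z * w) (pauli R)"
      by (simp add: z w cscale_mult_left cscale_mult_right)
    then show ?thesis using z w by (metis mult_1 power_mult_distrib)
  qed
  then show ?thesis using g h by (auto simp: Cliff_iff intro: unitary_mult)
qed

lemma one_in_Cliff: "(mat 1 :: 'm::finite qop) \<in> Cliff"
proof -
  have "\<exists>z Q. z ^ 4 = 1 \<and> mat 1 ** pauli P ** dagger (mat 1) = cscale z (pauli Q)" for P :: "'m pauli_label"
    by (intro exI[of _ 1] exI[of _ P]) simp
  then show ?thesis unfolding Cliff_iff using unitary_one by blast
qed

lemma bsgn_phase: "bsgn c ^ 4 = 1"
  by (simp add: bsgn_def)

lemma pauli_in_Cliff: "pauli P \<in> Cliff"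
  unfolding Cliff_iff pauli_conj using bsgn_phase unitary_pauli by blast

text \<open>With K = \<i> E(V) up to sign one has K K = -1 and K is anti-Hermitian, so g = (1 + K) /
  \<open>sqrt 2\<close> is unitary and g g = K. A Pauli matrix commuting with K is fixed by g; for
  an anticommuting P, conjugation gives g g P = K P, which has label V + P up to phase.\<close>

lemma transvection_Cliff:
  fixes V :: "'m::finite pauli_label"
  shows "\<exists>g\<in>Cliff. \<forall>P. \<exists>z. z ^ 4 = 1 \<and> g ** pauli P ** dagger g = cscale z (pauli (transvect V P))"
proof -
  \<comment> \<open>The phase that makes \<open>pauli V\<close> Hermitian; it agrees up to sign with
    the one in E(V).\<close>
  define e where "e = (if bdot (fst V) (snd V) = 1 then \<i> else 1)"
  define K where "K = cscale (\<i> * e) (pauli V)"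
  have e: "e * e = bsgn (bdot (fst V) (snd V))" "cnj e * bsgn (bdot (fst V) (snd V)) = e" "e ^ 4 = 1"
    by (simp_all add: e_def power4_eq_xxxx)
  have neg: "cscale (-1) A = - A" for A :: "'m qop" by (simp add: vec_eq_iff)
  have KK: "K ** K = - mat 1"
    using e(1) by (simp add: K_def cscale_mult_left cscale_mult_right pauli_mult mult_ac bdot_commute neg)
       (simp add: mult.assoc[symmetric] neg)
  have dK: "dagger K = - K"
  proof -
    have "dagger K = cscale (- (\<i> * (cnj e * bsgn (bdot (fst V) (snd V))))) (pauli V)"
      by (simp add: K_def dagger_cscale pauli_dagger mult.assoc)
    also have "\<dots> = - K" by (simp only: e(2) K_def) (simp add: vec_eq_iff)
    finally show ?thesis .
  qed
  define c where "c = complex_of_real (1 / sqrt 2)"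
  have "c * c = of_real (1 / sqrt 2 * (1 / sqrt 2))" by (simp only: c_def of_real_mult)
  also have "1 / sqrt 2 * (1 / sqrt 2) = 1 / 2" by simp
  finally have c: "c * c = 1 / 2" "cnj c = c" by (simp_all add: c_def)
  define g where "g = cscale c (mat 1 + K)"
  have dg: "dagger g = cscale c (mat 1 - K)"
    by (simp add: g_def dagger_cscale c dagger_add dK)
  have two: "cscale (1/2) (A + A) = A" for A :: "'m qop" by (simp add: vec_eq_iff)
  have gg: "g ** g = K"
  proof -
    have "g ** g = cscale (c * c) ((mat 1 + K) ** (mat 1 + K))"
      by (simp only: g_def cscale_mult_left cscale_mult_right cscale_cscale)
    moreover have "(mat 1 + K) ** (mat 1 + K) = K + K"
      by (simp add: matrix_mult_add_left matrix_add_ldistrib KK)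
    ultimately show ?thesis by (simp only: c two)
  qed
  have "g ** dagger g = mat 1" "dagger g ** g = mat 1"
  proof -
    have "g ** dagger g = cscale (c * c) ((mat 1 + K) ** (mat 1 - K))"
      "dagger g ** g = cscale (c * c) ((mat 1 - K) ** (mat 1 + K))"
      unfolding dg unfolding g_def by (simp_all only: cscale_mult_left cscale_mult_right cscale_cscale)
    moreover have "(mat 1 + K) ** (mat 1 - K) = mat 1 + mat 1" "(mat 1 - K) ** (mat 1 + K) = mat 1 + mat 1"
      by (simp_all add: matrix_mult_add_left matrix_add_ldistrib matrix_mult_diff_left matrix_mult_diff_right KK)
    ultimately show "g ** dagger g = mat 1" "dagger g ** g = mat 1" by (simp_all only: c two)
  qed
  then have u: "unitary_mat g" by (simp add: unitary_mat_def)
  have act: "\<exists>z. z ^ 4 = 1 \<and> g ** pauli P ** dagger g = cscale z (pauli (transvect V P))" for P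
  proof (cases "sympl V P = 1")
    case False
    then have "K ** pauli P = pauli P ** K"
      by (simp add: K_def cscale_mult_left cscale_mult_right pauli_commute[of V P])
    then have "g ** pauli P = pauli P ** g"
      by (simp add: g_def cscale_mult_left cscale_mult_right matrix_mult_add_left matrix_add_ldistrib)
    then have "g ** pauli P ** dagger g = cscale 1 (pauli (transvect V P))"
      using False u by (simp add: unitary_cancel transvect_def)
    then show ?thesis by (metis power_one)
  next
    case True
    then have "pauli P ** K = - (K ** pauli P)"
      by (simp add: K_def cscale_mult_left cscale_mult_right pauli_commute[of V P] vec_eq_iff)
    \<comment> \<open>Anticommutation turns P (1 - K) into (1 + K) P.\<close>
    then have "pauli P ** dagger g = g ** pauli P"
      unfolding dg unfolding g_def by (simp add: cscale_mult_left cscale_mult_right matrix_mult_add_left matrix_mult_diff_right)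
    then have "g ** pauli P ** dagger g = g ** g ** pauli P"
      by (simp add: matrix_mul_assoc[symmetric])
    also have "\<dots> = cscale (\<i> * e * bsgn (bdot (snd V) (fst P))) (pauli (transvect V P))"
      using True by (simp add: gg K_def cscale_mult_left pauli_mult transvect_def)
    finally have "g ** pauli P ** dagger g = cscale (\<i> * e * bsgn (bdot (snd V) (fst P))) (pauli (transvect V P))" .
    moreover have "(\<i> * e * bsgn (bdot (snd V) (fst P))) ^ 4 = 1"
      by (simp add: power_mult_distrib e(3) bsgn_phase)
    ultimately show ?thesis by blast
  qed
  then have "g \<in> Cliff" unfolding Cliff_iff using u by blast
  then show ?thesis using act by blast
qed

text \<open>The product of the adjoint of g with h commutes with all Pauli matrices, hence is
  scalar; unitarity gives the scalar modulus one.\<close>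

lemma Cliff_phase_unique:
  fixes g h :: "'m::finite qop"
  assumes u: "unitary_mat g" "unitary_mat h"
    and eq: "\<And>P. g ** pauli P ** dagger g = h ** pauli P ** dagger h"
  shows "\<exists>c. cmod c = 1 \<and> h = cscale c g"
proof -
  have "pauli P ** (dagger g ** h) = dagger g ** h ** pauli P" for P
  proof -
    have "dagger g ** (g ** pauli P ** dagger g) ** h = dagger g ** (h ** pauli P ** dagger h) ** h"
      using eq by simp
    then show ?thesis using u by (simp add: matrix_mul_assoc) (simp add: unitary_mat_def matrix_mul_assoc unitary_cancel)
  qed
  then obtain c where "dagger g ** h = cscale c (mat 1)" using commutes_with_paulis_scalar by blast
  then have "g ** (dagger g ** h) = cscale c g" by (simp add: cscale_mult_right)
  then have h: "h = cscale c g" using unitary_cancel(2)[OF u(1)] by simp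
  have "cscale (c * cnj c) (mat 1) = (mat 1 :: 'm qop)"
    using u by (simp add: unitary_mat_def h dagger_cscale cscale_mult_left cscale_mult_right mult.commute)
  then have "cscale (c * cnj c) (mat 1 :: 'm qop) $ 0 $ 0 = (mat 1 :: 'm qop) $ 0 $ 0" by (simp only:)
  then have "c * cnj c = 1" by (simp add: mat_def)
  then have "(cmod c)\<^sup>2 = 1" by (metis complex_norm_square of_real_eq_1_iff)
  then show ?thesis using h by (auto simp: power2_eq_1_iff) (metis norm_ge_zero not_one_le_zero neg_0_le_iff_le)
qed

lemma equiv_cliff_phase_rel: "equiv (Cliff :: 'm::finite qop set) cliff_phase_rel"
proof (rule equivI)
  show "refl_on (Cliff :: 'm qop set) cliff_phase_rel"
    by (auto simp: refl_on_def cliff_phase_rel_def intro: exI[of _ 1])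
  show "sym (cliff_phase_rel :: 'm qop rel)"
  proof (rule symI)
    fix g h :: "'m qop" assume "(g, h) \<in> cliff_phase_rel"
    then obtain c where c: "g \<in> Cliff" "h \<in> Cliff" "cmod c = 1" "h = cscale c g"
      by (auto simp: cliff_phase_rel_def)
    then have "g = cscale (cnj c) h" "cmod (cnj c) = 1"
      using cmod_1_mult_cnj[OF c(3)] by (simp_all add: mult.commute)
    then show "(h, g) \<in> cliff_phase_rel" using c(1,2) unfolding cliff_phase_rel_def by blast
  qed
  show "trans (cliff_phase_rel :: 'm qop rel)"
  proof (rule transI)
    fix f g h :: "'m qop" assume "(f, g) \<in> cliff_phase_rel" "(g, h) \<in> cliff_phase_rel"
    then obtain c d where "f \<in> Cliff" "h \<in> Cliff" "cmod c = 1" "g = cscale c f" "cmod d = 1" "h = cscale d g"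
      by (auto simp: cliff_phase_rel_def)
    then have "f \<in> Cliff" "h \<in> Cliff" "cmod (d * c) = 1" "h = cscale (d * c) f" by (simp_all add: norm_mult)
    then show "(f, h) \<in> cliff_phase_rel" unfolding cliff_phase_rel_def by blast
  qed
  show "(cliff_phase_rel :: 'm qop rel) \<subseteq> Cliff \<times> Cliff" by (auto simp: cliff_phase_rel_def)
qed

lemma finite_HW: "finite (HW :: 'm::finite qop set)"
proof -
  have "(HW :: 'm qop set) \<subseteq> (\<lambda>(k, a, b). cscale (\<i> ^ k) (pauli_D a b)) ` ({..<4::nat} \<times> UNIV)"
  proof
    fix M :: "'m qop" assume "M \<in> HW"
    then obtain k a b where "M = cscale (\<i> ^ k) (pauli_D a b)" "k < 4" unfolding HW_def by blast
    then show "M \<in> (\<lambda>(k, a, b). cscale (\<i> ^ k) (pauli_D a b)) ` ({..<4::nat} \<times> UNIV)"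
      by (intro image_eqI[of _ _ "(k, a, b)"]) auto
  qed
  then show ?thesis by (rule finite_subset) simp
qed

definition cliff_twirl :: "('m::finite qop set \<Rightarrow> 'm qop) \<Rightarrow>
    complex^('m bits^'k::finite)^('m bits^'k) \<Rightarrow> complex^('m bits^'k)^('m bits^'k)"
  where "cliff_twirl rep = ensemble_twirl (Cliff // cliff_phase_rel) rep"

section \<open>Conjugation of Pauli tensors and sums over orbits\<close>

lemma sympl_sum_right: "sympl R (\<Sum>i\<in>S. f i) = (\<Sum>i\<in>S. sympl R (f i))"
  by (induction S rule: infinite_finite_induct) (simp_all add: sympl_add_right)

text \<open>The signs of the factors multiply to a character of R evaluated against the total label;
  only a zero total label survives averaging over R.\<close>

lemma tensor_conj_pauli_tensor:
  "tensor_conj (pauli R) (tensor (\<lambda>i. pauli (f i))) =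
    cscale (bsgn (sympl R (\<Sum>i\<in>UNIV. f i))) (tensor (\<lambda>i. pauli (f i)))"
  by (simp add: tensor_conj_tensor pauli_conj tensor_cscale sympl_sum_right bsgn_sum)

lemma cscale_minus_one_fixed:
  assumes "A = cscale (-1) A"
  shows "A = 0"
proof -
  have "A $ i $ j = - A $ i $ j" for i j
    using arg_cong[OF assms, of "\<lambda>M. M $ i $ j"] by simp
  then show ?thesis by (simp add: vec_eq_iff)
qed

text \<open>The orbit step: if the twirl is constant on an orbit, each value is the orbit sum
  divided by the size of the orbit.\<close>

lemma constant_summand_fixed:
  assumes "finite S" "x \<in> S" "\<And>y. y \<in> S \<Longrightarrow> A y = A x" "(\<Sum>y\<in>S. A y) \<in> twirl_fixed"
  shows "A x \<in> twirl_fixed"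
proof -
  have "(\<Sum>y\<in>S. A y) = real (card S) *\<^sub>R A x"
    using assms(3) by (simp add: sum_constant_scaleR del: sum_constant)
  moreover have "card S \<noteq> 0" using assms(1,2) by auto
  ultimately have "A x = (1 / real (card S)) *\<^sub>R (\<Sum>y\<in>S. A y)" by simp
  then show ?thesis using assms(4) twirl_fixed_closed(3) by metis
qed

lemma pair_tensor_zero [simp]: "pair_tensor i j 0 = mat 1"
  by (simp add: pair_tensor_def tensor_one cong: if_cong)

lemma conj_dagger: "U ** dagger A ** dagger U = dagger (U ** A ** dagger U)"
  by (simp add: dagger_mult matrix_mul_assoc)

lemma conj_mult:
  assumes "unitary_mat U"
  shows "U ** (A ** B) ** dagger U = (U ** A ** dagger U) ** (U ** B ** dagger U)"
proof -
  have "U ** A ** dagger U ** (U ** B ** dagger U) = U ** A ** (dagger U ** U) ** B ** dagger U"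
    by (simp add: matrix_mul_assoc)
  also have "\<dots> = U ** (A ** B) ** dagger U"
    using assms by (simp add: unitary_mat_def) (simp add: matrix_mul_assoc)
  finally show ?thesis ..
qed

lemma tensor_conj_pair_tensor:
  assumes U: "unitary_mat U" and ij: "i \<noteq> j"
    and P: "U ** pauli P ** dagger U = cscale z (pauli P')" and z: "cmod z = 1"
  shows "tensor_conj U (pair_tensor i j P) = pair_tensor i j P'"
proof -
  have "tensor_conj U (pair_tensor i j P) =
    tensor (\<lambda>l. cscale (if l = i then z else if l = j then cnj z else 1)
       (if l = i then pauli P' else if l = j then dagger (pauli P') else mat 1))"
    unfolding pair_tensor_def tensor_conj_tensor
    by (intro arg_cong[of _ _ tensor] ext) (use U in \<open>simp add: conj_dagger P dagger_cscale unitary_mat_def\<close>)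
  also have "\<dots> = cscale (\<Prod>l\<in>UNIV. if l = i then z else if l = j then cnj z else 1) (pair_tensor i j P')"
    by (simp add: tensor_cscale pair_tensor_def)
  also have "(\<Prod>l\<in>UNIV. if l = i then z else if l = j then cnj z else 1) = (\<Prod>l\<in>{i, j}. if l = i then z else cnj z)"
    by (rule prod.mono_neutral_cong_right) auto
  also have "\<dots> = 1" using ij cmod_1_mult_cnj[OF z] by simp
  finally show ?thesis by simp
qed

section \<open>The Clifford group is a 3-design\<close>

text \<open>The adjoint in the third factor makes the phases cancel under Clifford conjugation.\<close>

definition triple_tensor :: "'m::finite pauli_label \<Rightarrow> 'm pauli_label \<Rightarrow> complex^('m bits^3)^('m bits^3)"
  where "triple_tensor P Q =
    tensor (\<lambda>l. if l = 1 then pauli P else if l = 2 then pauli Q else dagger (pauli P ** pauli Q))"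

lemma distinct_3: "(1 :: 3) \<noteq> 2" "(1 :: 3) \<noteq> 3" "(2 :: 3) \<noteq> 3" "(2 :: 3) \<noteq> 1" "(3 :: 3) \<noteq> 1" "(3 :: 3) \<noteq> 2"
  by simp_all

lemma prod_UNIV_3: "(\<Prod>l\<in>(UNIV :: 3 set). h l) = (h 1 * h 2 * h 3 :: complex)"
  unfolding UNIV_3 by (simp add: mult.assoc distinct_3)

lemma tensor_3_cong:
  assumes "M 1 = M' 1" "M 2 = M' 2" "M 3 = M' (3 :: 3)"
  shows "tensor M = tensor M'"
proof -
  have "M i = M' i" for i using exhaust_3[of i] assms by (elim disjE) simp_all
  then have "M = M'" by (rule ext)
  then show ?thesis by (rule arg_cong)
qed

lemma tensor_conj_triple_tensor:
  assumes U: "unitary_mat U"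
    and P: "U ** pauli P ** dagger U = cscale z (pauli P')" "cmod z = 1"
    and Q: "U ** pauli Q ** dagger U = cscale w (pauli Q')" "cmod w = 1"
  shows "tensor_conj U (triple_tensor P Q) = triple_tensor P' Q'"
proof -
  have "tensor_conj U (triple_tensor P Q) =
    tensor (\<lambda>l::3. cscale (if l = 1 then z else if l = 2 then w else cnj (z * w))
       (if l = 1 then pauli P' else if l = 2 then pauli Q' else dagger (pauli P' ** pauli Q')))"
    unfolding triple_tensor_def tensor_conj_tensor
    by (rule tensor_3_cong)
      (simp_all add: distinct_3 P(1) Q(1) conj_dagger conj_mult[OF U] dagger_cscale cscale_mult_left cscale_mult_right mult.commute)
  also have "\<dots> = cscale (z * w * cnj (z * w)) (triple_tensor P' Q')"
    by (simp add: tensor_cscale prod_UNIV_3 distinct_3 triple_tensor_def)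
  also have "z * w * cnj (z * w) = 1"
    by (rule cmod_1_mult_cnj) (simp add: norm_mult P Q)
  finally show ?thesis by simp
qed

text \<open>For P = Q the third factor is a sign times the identity, and the same sign turns the
  second factor into the adjoint of the first.\<close>

lemma triple_tensor_degenerate:
  "triple_tensor 0 Q = pair_tensor 2 3 Q"
  "triple_tensor P 0 = pair_tensor 1 3 P"
  "triple_tensor P P = pair_tensor 1 2 P"
proof -
  show "triple_tensor 0 Q = pair_tensor 2 3 Q" "triple_tensor P 0 = pair_tensor 1 3 P"
    unfolding triple_tensor_def pair_tensor_def by (rule tensor_3_cong; simp add: distinct_3)+
  let ?s = "bsgn (bdot (fst P) (snd P))"
  have "triple_tensor P P = tensor (\<lambda>l::3. cscale (if l = 1 then 1 else ?s)
      (if l = 1 then pauli P else if l = 2 then dagger (pauli P) else mat 1))"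
    unfolding triple_tensor_def
    by (rule tensor_3_cong) (simp_all add: distinct_3 pauli_dagger pauli_mult dagger_cscale bdot_commute)
  also have "\<dots> = pair_tensor 1 2 P"
    unfolding tensor_cscale pair_tensor_def by (simp add: prod_UNIV_3 distinct_3)
  finally show "triple_tensor P P = pair_tensor 1 2 P" .
qed

text \<open>The third factors multiply to the adjoint of P Q in one order and of Q P in the other;
  this is the origin of the commutation sign.\<close>

lemma triple_tensor_product:
  "pair_tensor 2 3 Q ** pair_tensor 1 3 P = triple_tensor P Q"
  "pair_tensor 1 3 P ** pair_tensor 2 3 Q = cscale (bsgn (sympl P Q)) (triple_tensor P Q)"
proof -
  show "pair_tensor 2 3 Q ** pair_tensor 1 3 P = triple_tensor P Q"
    unfolding triple_tensor_def pair_tensor_def tensor_mult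
    by (rule tensor_3_cong) (simp_all add: distinct_3 dagger_mult)
  have "dagger (pauli P) ** dagger (pauli Q) = cscale (bsgn (sympl P Q)) (dagger (pauli P ** pauli Q))"
    unfolding dagger_mult[symmetric] by (simp add: pauli_commute[of P Q] dagger_cscale)
  then have "pair_tensor 1 3 P ** pair_tensor 2 3 Q =
      tensor (\<lambda>l::3. cscale (if l = 3 then bsgn (sympl P Q) else 1)
        (if l = 1 then pauli P else if l = 2 then pauli Q else dagger (pauli P ** pauli Q)))"
    unfolding pair_tensor_def tensor_mult
    by (intro tensor_3_cong) (simp_all add: distinct_3)
  also have "\<dots> = cscale (bsgn (sympl P Q)) (triple_tensor P Q)"
    unfolding tensor_cscale triple_tensor_def by (simp add: prod_UNIV_3 distinct_3)
  finally show "pair_tensor 1 3 P ** pair_tensor 2 3 Q = cscale (bsgn (sympl P Q)) (triple_tensor P Q)" .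
qed

lemma sum_UNIV_pair: "(\<Sum>(x, y)\<in>UNIV. f x y) = (\<Sum>x\<in>UNIV. \<Sum>y\<in>UNIV. f x y)"
  unfolding sum.cartesian_product UNIV_Times_UNIV by (rule refl)

lemma sum_triple_tensor_fixed:
  "(\<Sum>(P, Q)\<in>{(P, Q). sympl P Q = c}. triple_tensor P (Q :: 'm::finite pauli_label)) \<in> twirl_fixed"
proof -
  let ?S = "\<lambda>i. (\<Sum>P\<in>UNIV. pair_tensor i 3 P) :: complex^('m bits^3)^('m bits^3)"
  have S: "?S 1 \<in> twirl_fixed" "?S 2 \<in> twirl_fixed"
    by (simp_all add: sum_pair_tensor_fixed distinct_3)
  have a: "(\<Sum>(P, Q)\<in>UNIV. triple_tensor P Q) = ?S 2 ** ?S 1"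
    unfolding sum_UNIV_pair matrix_mult_sum_left matrix_mult_sum_right triple_tensor_product by (rule refl)
  have b: "(\<Sum>(P, Q)\<in>UNIV. cscale (bsgn (sympl P Q)) (triple_tensor P Q)) = ?S 1 ** ?S 2"
    unfolding sum_UNIV_pair matrix_mult_sum_left matrix_mult_sum_right triple_tensor_product by (rule sum.swap)
  \<comment> \<open>The indicator of two equal bits is half of one plus the product of their signs;
    it combines the plain and the weighted sum.\<close>
  have pt: "(if sympl P Q = c then triple_tensor P Q else 0) = cscale (1/2) (triple_tensor P Q) +
      cscale (bsgn c / 2) (cscale (bsgn (sympl P Q)) (triple_tensor P Q))" for P Q :: "'m pauli_label"
    by (cases "sympl P Q"; cases c) (simp_all add: vec_eq_iff)
  have "(\<Sum>(P, Q)\<in>{(P, Q). sympl P Q = c}. triple_tensor P (Q :: 'm pauli_label)) =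
     (\<Sum>(P, Q)\<in>UNIV. if sympl P Q = c then triple_tensor P Q else 0)"
    by (rule sum.mono_neutral_cong_left) (auto split: if_split_asm)
  also have "\<dots> = (\<Sum>(P, Q)\<in>UNIV. cscale (1/2) (triple_tensor P Q) +
      cscale (bsgn c / 2) (cscale (bsgn (sympl P Q)) (triple_tensor P Q)))"
    unfolding pt by (rule refl)
  also have "\<dots> = cscale (1/2) (?S 2 ** ?S 1) + cscale (bsgn c / 2) (?S 1 ** ?S 2)"
    unfolding a[symmetric] b[symmetric] cscale_sum by (simp add: sum.distrib case_prod_unfold)
  finally show ?thesis using S by (simp add: twirl_fixed_closed)
qed

context
  fixes rep :: "'m::finite qop set \<Rightarrow> 'm qop"
  assumes rep: "\<forall>C \<in> Cliff // cliff_phase_rel. rep C \<in> C"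
begin

lemma rep_class:
  assumes "C \<in> Cliff // cliff_phase_rel"
  shows "rep C \<in> Cliff" "cliff_phase_rel `` {rep C} = C"
proof -
  have C: "rep C \<in> C" "C \<subseteq> Cliff"
    using rep assms equiv_cliff_phase_rel by (auto dest: in_quotient_imp_subset)
  then show "rep C \<in> Cliff" by blast
  show "cliff_phase_rel `` {rep C} = C"
  proof -
    obtain x where x: "C = cliff_phase_rel `` {x}" using assms by (rule quotientE)
    then have "(x, rep C) \<in> cliff_phase_rel" using C(1) by simp
    then show ?thesis unfolding x by (rule sym[OF equiv_class_eq[OF equiv_cliff_phase_rel]])
  qed
qed

text \<open>A class is determined by how its representative conjugates the finitely many Pauli
  matrices, and the results lie in the finite set \<open>HW\<close>.\<close>

lemma finite_cliff_classes: "finite (Cliff // (cliff_phase_rel :: 'm qop rel))"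
proof -
  let ?f = "\<lambda>C P. rep C ** pauli P ** dagger (rep C)"
  have "inj_on ?f (Cliff // cliff_phase_rel)"
  proof (rule inj_onI)
    fix C D assume CD: "C \<in> Cliff // cliff_phase_rel" "D \<in> Cliff // cliff_phase_rel" and eq: "?f C = ?f D"
    have "\<exists>c. cmod c = 1 \<and> rep D = cscale c (rep C)"
      by (rule Cliff_phase_unique) (use rep_class CD Cliff_unitary fun_cong[OF eq] in auto)
    then have "(rep C, rep D) \<in> cliff_phase_rel"
      using rep_class(1) CD by (simp add: cliff_phase_rel_def)
    then show "C = D" using rep_class(2) CD equiv_class_eq[OF equiv_cliff_phase_rel] by metis
  qed
  moreover have "?f ` (Cliff // cliff_phase_rel) \<subseteq> PiE UNIV (\<lambda>_. HW)"
    using rep_class(1) by (auto simp: Cliff_def pauli_def)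
  ultimately show ?thesis
    by (meson finite_HW finite_PiE finite_imageD finite_subset finite_class.finite_UNIV)
qed

lemma cliff_classes_nonempty: "Cliff // (cliff_phase_rel :: 'm qop rel) \<noteq> {}"
  using one_in_Cliff by (metis empty_iff quotientI)

text \<open>Right multiplication by g permutes the classes. The chosen representative of the new
  class differs from \<open>rep C ** g\<close> only by a phase, which conjugation ignores.\<close>

lemma cliff_twirl_right_invariant:
  assumes g: "g \<in> Cliff"
  shows "cliff_twirl rep (tensor_conj g X) = cliff_twirl rep X"
proof -
  let ?Q = "Cliff // (cliff_phase_rel :: 'm qop rel)"
  define p where "p C = cliff_phase_rel `` {rep C ** g}" for C
  have pQ: "p C \<in> ?Q" if "C \<in> ?Q" for C
    unfolding p_def using that g rep_class by (intro quotientI Cliff_mult) auto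
  have rel: "(rep C ** g, rep (p C)) \<in> cliff_phase_rel" if "C \<in> ?Q" for C
    using rep[rule_format, OF pQ[OF that]] by (simp add: p_def)
  have "inj_on p ?Q"
  proof (rule inj_onI)
    fix C D assume CD: "C \<in> ?Q" "D \<in> ?Q" "p C = p D"
    have "(rep C ** g, rep D ** g) \<in> cliff_phase_rel"
      using CD rel equiv_cliff_phase_rel by (metis equivE symE transE)
    then obtain c where c: "cmod c = 1" "rep D ** g = cscale c (rep C ** g)"
      by (auto simp: cliff_phase_rel_def)
    then have "rep D ** g ** dagger g = cscale c (rep C ** g ** dagger g)" by (simp add: cscale_mult_left)
    then have "rep D = cscale c (rep C)" using unitary_cancel(3)[OF Cliff_unitary[OF g]] by metis
    moreover have "rep C \<in> Cliff" "rep D \<in> Cliff" using rep_class(1) CD by auto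
    ultimately have "(rep C, rep D) \<in> cliff_phase_rel"
      using c(1) unfolding cliff_phase_rel_def by blast
    then show "C = D" using rep_class(2) CD equiv_class_eq[OF equiv_cliff_phase_rel] by metis
  qed
  then have bij: "bij_betw p ?Q ?Q"
    unfolding bij_betw_def using endo_inj_surj[OF finite_cliff_classes] pQ by blast
  have "tensor_conj (rep (p C)) X = tensor_conj (rep C) (tensor_conj g X)" if C: "C \<in> ?Q" for C
  proof -
    obtain c where "cmod c = 1" "rep (p C) = cscale c (rep C ** g)"
      using rel[OF C] by (auto simp: cliff_phase_rel_def)
    then show ?thesis by (simp add: tensor_conj_phase tensor_conj_comp)
  qed
  then have "cliff_twirl rep (tensor_conj g X) = (\<Sum>C\<in>?Q. (1 / real (card ?Q)) *\<^sub>R tensor_conj (rep (p C)) X)"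
    by (simp add: cliff_twirl_def ensemble_twirl_def)
  also have "\<dots> = cliff_twirl rep X"
    unfolding cliff_twirl_def ensemble_twirl_def by (rule sum.reindex_bij_betw[OF bij])
  finally show ?thesis .
qed

lemma cliff_twirl_fixed: "X \<in> twirl_fixed \<Longrightarrow> cliff_twirl rep X = X"
  unfolding cliff_twirl_def
  by (intro ensemble_twirl_const finite_cliff_classes cliff_classes_nonempty twirl_fixedD Cliff_unitary rep_class)

abbreviation "ctwirl \<equiv> (cliff_twirl rep :: complex^('m bits^3)^('m bits^3) \<Rightarrow> _)"

text \<open>A Clifford element realising the transvection acts on the triple without phase and is
  absorbed by right invariance.\<close>

lemma ctwirl_transvect: "ctwirl (triple_tensor (transvect V P) (transvect V Q)) = ctwirl (triple_tensor P Q)"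
proof -
  obtain g where g: "g \<in> Cliff"
    "\<And>P. \<exists>z. z ^ 4 = 1 \<and> g ** pauli P ** dagger g = cscale z (pauli (transvect V P))"
    using transvection_Cliff by blast
  obtain z w where "z ^ 4 = 1" "g ** pauli P ** dagger g = cscale z (pauli (transvect V P))"
     "w ^ 4 = 1" "g ** pauli Q ** dagger g = cscale w (pauli (transvect V Q))"
    using g(2) by metis
  then have "tensor_conj g (triple_tensor P Q) = triple_tensor (transvect V P) (transvect V Q)"
    by (intro tensor_conj_triple_tensor Cliff_unitary g(1) phase_cmod)
  then show ?thesis using cliff_twirl_right_invariant[OF g(1)] by metis
qed

lemma ctwirl_sum: "ctwirl (\<Sum>x\<in>S. M x) = (\<Sum>x\<in>S. ctwirl (M x))"
  unfolding cliff_twirl_def by (rule ensemble_twirl_sum)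

lemma ctwirl_cscale: "ctwirl (cscale c X) = cscale c (ctwirl X)"
  unfolding cliff_twirl_def by (rule ensemble_twirl_cscale)

lemma ctwirl_fixed: "X \<in> twirl_fixed \<Longrightarrow> ctwirl X \<in> twirl_fixed"
  using cliff_twirl_fixed by metis

text \<open>The maps a and b let the three degenerate kinds of triples share one proof. The twirl is
  constant on P \<noteq> 0, and the sum over these is a multiple of a swap minus the
  identity.\<close>

lemma ctwirl_pair_fixed:
  assumes h: "\<And>P. ctwirl (pair_tensor i j P) = ctwirl (triple_tensor (a P) (b P))"
    and ab: "\<And>V P. a (transvect V P) = transvect V (a P)" "\<And>V P. b (transvect V P) = transvect V (b P)"
    and ij: "i \<noteq> j"
  shows "ctwirl (pair_tensor i j P) \<in> twirl_fixed"
proof (cases "P = 0")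
  case True
  then show ?thesis by (simp add: ctwirl_fixed twirl_fixed_closed)
next
  case False
  have "ctwirl (pair_tensor i j (transvect V P)) = ctwirl (pair_tensor i j P)" for V P
    by (simp add: h ab ctwirl_transvect)
  then have c: "ctwirl (pair_tensor i j P') = ctwirl (pair_tensor i j P)" if "P' \<noteq> 0" for P'
    using transvect_transitive[OF False that] by metis
  have "(\<Sum>P\<in>UNIV - {0}. ctwirl (pair_tensor i j P)) = (\<Sum>P\<in>UNIV. ctwirl (pair_tensor i j P)) - ctwirl (mat 1)"
    by (simp add: sum_diff)
  also have "\<dots> \<in> twirl_fixed"
    unfolding ctwirl_sum[symmetric] by (intro twirl_fixed_closed ctwirl_fixed sum_pair_tensor_fixed ij)
  finally have sum: "(\<Sum>P\<in>UNIV - {0}. ctwirl (pair_tensor i j P)) \<in> twirl_fixed" .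
  show ?thesis
  proof (rule constant_summand_fixed[where S = "UNIV - {0}" and A = "\<lambda>P. ctwirl (pair_tensor i j P)"])
    show "ctwirl (pair_tensor i j P') = ctwirl (pair_tensor i j P)" if "P' \<in> UNIV - {0}" for P'
      by (rule c) (use that in simp)
  qed (use False sum in simp_all)
qed

lemma ctwirl_degenerate:
  "ctwirl (triple_tensor 0 P) \<in> twirl_fixed" "ctwirl (triple_tensor P 0) \<in> twirl_fixed" "ctwirl (triple_tensor P P) \<in> twirl_fixed"
  unfolding triple_tensor_degenerate
  by (rule ctwirl_pair_fixed[where a = "\<lambda>_. 0" and b = "\<lambda>P. P"] ctwirl_pair_fixed[where a = "\<lambda>P. P" and b = "\<lambda>_. 0"]
     ctwirl_pair_fixed[where a = "\<lambda>P. P" and b = "\<lambda>P. P"]; simp add: triple_tensor_degenerate distinct_3; fail)+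

text \<open>The sum over independent pairs with the given symplectic product is the sum over all
  such pairs minus the degenerate ones, both in the commutant; by Witt's theorem its terms are all
  equal.\<close>

lemma ctwirl_triple_fixed: "ctwirl (triple_tensor P Q) \<in> twirl_fixed"
proof (cases "P = 0 \<or> Q = 0 \<or> Q = P")
  case True
  then show ?thesis using ctwirl_degenerate[of P] ctwirl_degenerate[of Q] by (elim disjE) simp_all
next
  case False
  define S where "S = {(P' :: 'm pauli_label, Q'). sympl P' Q' = sympl P Q}"
  define D where "D = {(P' :: 'm pauli_label, Q'). P' = 0 \<or> Q' = 0 \<or> Q' = P'}"
  let ?A = "\<lambda>(P', Q'). ctwirl (triple_tensor P' Q')"
  have "(\<Sum>x\<in>S - D. ?A x) = (\<Sum>x\<in>S. ?A x) - (\<Sum>x\<in>S \<inter> D. ?A x)"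
    using sum.Int_Diff[of S ?A D] by simp
  moreover have "(\<Sum>x\<in>S. ?A x) \<in> twirl_fixed"
  proof -
    have "(\<Sum>x\<in>S. ?A x) = ctwirl (\<Sum>(P', Q')\<in>S. triple_tensor P' Q')"
      by (simp add: ctwirl_sum case_prod_unfold)
    then show ?thesis unfolding S_def using ctwirl_fixed[OF sum_triple_tensor_fixed] by (simp only:)
  qed
  moreover have "(\<Sum>x\<in>S \<inter> D. ?A x) \<in> twirl_fixed"
  proof (rule twirl_fixed_closed)
    fix x assume "x \<in> S \<inter> D"
    moreover obtain P' Q' where "x = (P', Q')" by (rule prod.exhaust)
    ultimately have "P' = 0 \<or> Q' = 0 \<or> Q' = P'" and x: "x = (P', Q')" by (simp_all add: D_def)
    then show "?A x \<in> twirl_fixed"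
      unfolding x prod.case using ctwirl_degenerate[of P'] ctwirl_degenerate[of Q'] by (elim disjE) simp_all
  qed
  ultimately have "(\<Sum>x\<in>S - D. ?A x) \<in> twirl_fixed" by (simp add: twirl_fixed_closed)
  moreover have "(P, Q) \<in> S - D" using False by (simp add: S_def D_def)
  moreover have "?A x = ?A (P, Q)" if "x \<in> S - D" for x
  proof -
    obtain P' Q' where x: "x = (P', Q')" by (rule prod.exhaust)
    have "ctwirl (triple_tensor P' Q') = ctwirl (triple_tensor P Q)"
      by (rule transvect_invariant_pair[where h = "\<lambda>P Q. ctwirl (triple_tensor P Q)", OF ctwirl_transvect]) (use that False in \<open>simp_all add: x S_def D_def\<close>)
    then show ?thesis by (simp add: x)
  qed
  ultimately have "?A (P, Q) \<in> twirl_fixed"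
    by (intro constant_summand_fixed[of "S - D" "(P, Q)" ?A] finite)
  then show ?thesis by simp
qed

text \<open>If the labels have nonzero sum, some Pauli matrix negates the tensor, so the invariant
  twirl equals its own negative. Otherwise the tensor is a sign times a triple.\<close>

lemma ctwirl_pauli_tensor_fixed: "ctwirl (tensor (\<lambda>i. pauli (f i))) \<in> twirl_fixed"
proof (cases "(\<Sum>i\<in>UNIV. f i) = 0")
  case False
  let ?X = "tensor (\<lambda>i. pauli (f i)) :: complex^('m bits^3)^('m bits^3)"
  obtain R where "sympl R (\<Sum>i\<in>UNIV. f i) = 1"
    using sympl_nondegenerate[OF False] sympl_commute by metis
  then have "tensor_conj (pauli R) ?X = cscale (-1) ?X" by (simp add: tensor_conj_pauli_tensor)
  then have "ctwirl ?X = cscale (-1) (ctwirl ?X)"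
    using cliff_twirl_right_invariant[OF pauli_in_Cliff[of R], of ?X] by (simp add: ctwirl_cscale)
  then have "ctwirl ?X = 0" by (rule cscale_minus_one_fixed)
  then show ?thesis by (simp add: twirl_fixed_zero)
next
  case True
  then have f3: "f 3 = f 1 + f 2" by (simp add: sum_3 label_add_eq_0)
  \<comment> \<open>\<open>?s\<close> comes from multiplying the first two factors,
    \<open>?t\<close> from the adjoint of the third.\<close>
  let ?s = "bsgn (bdot (snd (f 1)) (fst (f 2)))" and ?t = "bsgn (bdot (fst (f 3)) (snd (f 3)))"
  have "dagger (pauli (f 1) ** pauli (f 2)) = cscale (?s * ?t) (pauli (f 3))"
    by (simp add: pauli_mult dagger_cscale pauli_dagger f3)
  then have "pauli (f 3) = cscale (?s * ?t) (dagger (pauli (f 1) ** pauli (f 2)))"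
    by (simp add: mult.assoc mult.left_commute)
  then have "tensor (\<lambda>i. pauli (f i)) = tensor (\<lambda>l::3. cscale (if l = 3 then ?s * ?t else 1)
     (if l = 1 then pauli (f 1) else if l = 2 then pauli (f 2) else dagger (pauli (f 1) ** pauli (f 2))))"
    by (intro tensor_3_cong) (simp_all add: distinct_3)
  also have "\<dots> = cscale (?s * ?t) (triple_tensor (f 1) (f 2))"
    unfolding tensor_cscale triple_tensor_def by (simp add: prod_UNIV_3 distinct_3)
  finally show ?thesis by (simp add: ctwirl_cscale ctwirl_triple_fixed twirl_fixed_closed)
qed

theorem clifford_3_design:
  assumes "haar_unitary \<eta>"
  shows "uniform_unitary_design TYPE(3) \<eta> (Cliff // cliff_phase_rel) rep"
proof (rule uniform_design_criterion[OF assms finite_cliff_classes cliff_classes_nonempty])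
  show "unitary_mat (rep C)" if "C \<in> Cliff // cliff_phase_rel" for C
    using rep_class(1)[OF that] by (rule Cliff_unitary)
  show "ensemble_twirl (Cliff // cliff_phase_rel) rep X \<in> twirl_fixed" for X :: "complex^('m bits^3)^('m bits^3)"
    by (rule ensemble_twirl_fixedI) (use ctwirl_pauli_tensor_fixed in \<open>simp add: cliff_twirl_def\<close>)
qed

end

section \<open>Symplectic matrices induced by unitaries\<close>

definition sp_act :: "'m::finite sp_mat \<Rightarrow> 'm pauli_label \<Rightarrow> 'm pauli_label"
  where "sp_act F P = (let w = row_pair (fst P) (snd P) v* F in (row_fst w, row_snd w))"

lemma row_simps [simp]: "row_fst (row_pair a b) = a" "row_snd (row_pair a b) = b"
    "row_pair (row_fst w) (row_snd w) = w"
  by (simp_all add: row_fst_def row_snd_def row_pair_def vec_eq_iff split: sum.split)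

lemma row_add: "row_fst (v + w) = row_fst v + row_fst w" "row_snd (v + w) = row_snd v + row_snd w"
    "row_pair (a + a') (b + b') = row_pair a b + row_pair a' b'"
  by (simp_all add: row_fst_def row_snd_def row_pair_def vec_eq_iff split: sum.split)

lemma sp_act_add: "sp_act F (P + Q) = sp_act F P + sp_act F Q"
  by (simp add: sp_act_def Let_def row_add vector_matrix_left_distrib)

lemma sp_act_mult: "sp_act (F ** F') P = sp_act F' (sp_act F P)"
  by (simp add: sp_act_def Let_def vector_matrix_mul_assoc)

lemma bmat_eqI: "(\<And>w :: bit^'n. w v* A = w v* B) \<Longrightarrow> A = (B :: bit^'n^'n)"
proof -
  assume *: "\<And>w :: bit^'n. w v* A = w v* B"
  have "transpose A *v w = transpose B *v w" for w
    using * by (simp add: matrix_vector_mult_def transpose_def vector_matrix_mult_def vec_eq_iff mult.commute)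
  then have "transpose A = transpose B" by (simp add: matrix_eq)
  then show ?thesis by (metis transpose_transpose)
qed

lemma sp_act_eqD:
  assumes "\<And>P. sp_act F P = sp_act F' P"
  shows "F = F'"
proof -
  have "w v* F = w v* F'" for w
    using assms[of "(row_fst w, row_snd w)"] unfolding sp_act_def Let_def
    by (metis fst_conv snd_conv row_simps(3))
  then show ?thesis by (rule bmat_eqI)
qed

text \<open>E and D differ by a power of \<i>, and the inducing relation adds a sign; all that is
  kept is that the total phase has modulus one.\<close>

lemma induces_conj:
  assumes "induces g F"
  shows "\<exists>z. cmod z = 1 \<and> g ** pauli P ** dagger g = cscale z (pauli (sp_act F P))"
proof -
  let ?a = "fst P" and ?b = "snd P" and ?a' = "fst (sp_act F P)" and ?b' = "snd (sp_act F P)"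
  let ?z = "\<i> ^ int_inner ?a ?b" and ?z' = "\<i> ^ int_inner ?a' ?b'"
  have cm: "cmod (\<i> ^ n) = 1" for n by (simp add: norm_power)
  have "g ** pauli_E ?a ?b ** dagger g = pauli_E ?a' ?b' \<or> g ** pauli_E ?a ?b ** dagger g = - pauli_E ?a' ?b'"
    using assms by (simp add: induces_def sp_act_def Let_def)
  moreover have "- A = cscale (-1) A" for A :: "'a qop" by (simp add: vec_eq_iff)
  ultimately obtain s where s: "cmod s = 1" "g ** pauli_E ?a ?b ** dagger g = cscale s (pauli_E ?a' ?b')"
    by (metis cscale_one norm_minus_cancel norm_one)
  then have "cscale ?z (g ** pauli P ** dagger g) = cscale (s * ?z') (pauli (sp_act F P))"
    by (simp add: pauli_E_def pauli_def cscale_mult_left cscale_mult_right)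
  then have "cscale (cnj ?z * ?z) (g ** pauli P ** dagger g) = cscale (cnj ?z * (s * ?z')) (pauli (sp_act F P))"
    by (simp only: cscale_cscale[symmetric])
  moreover have "cnj ?z * ?z = 1" using cmod_1_mult_cnj[OF cm] by (simp only: mult.commute)
  ultimately have "g ** pauli P ** dagger g = cscale (cnj ?z * (s * ?z')) (pauli (sp_act F P))"
    by simp
  moreover have "cmod (cnj ?z * (s * ?z')) = 1" using s(1) by (simp add: norm_mult cm norm_power)
  ultimately show ?thesis by blast
qed

text \<open>Conjugating P Q and Q P produces the same phases, so the commutation signs before and
  after must agree.\<close>

lemma conj_preserves_sympl:
  assumes U: "unitary_mat U"
    and P: "U ** pauli P ** dagger U = cscale z (pauli P')" "cmod z = 1"
    and Q: "U ** pauli Q ** dagger U = cscale w (pauli Q')" "cmod w = 1"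
  shows "sympl P' Q' = sympl P Q"
proof -
  have "U ** (pauli P ** pauli Q) ** dagger U = cscale (z * w) (pauli P' ** pauli Q')"
    by (simp add: conj_mult[OF U] P Q cscale_mult_left cscale_mult_right mult.commute)
  moreover have "U ** (pauli P ** pauli Q) ** dagger U = cscale (bsgn (sympl P Q)) (U ** (pauli Q ** pauli P) ** dagger U)"
    by (simp add: pauli_commute[of P Q] cscale_mult_left cscale_mult_right)
  moreover have "U ** (pauli Q ** pauli P) ** dagger U = cscale (z * w) (pauli Q' ** pauli P')"
    by (simp add: conj_mult[OF U] P Q cscale_mult_left cscale_mult_right mult.commute)
  ultimately have "cscale (z * w * bsgn (sympl P' Q')) (pauli Q' ** pauli P') =
      cscale (z * w * bsgn (sympl P Q)) (pauli Q' ** pauli P')"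
    by (simp add: pauli_commute[of P' Q'] mult_ac)
  then have "cscale (z * w * bsgn (sympl P' Q')) (pauli Q' ** pauli P') ** dagger (pauli Q' ** pauli P') =
      cscale (z * w * bsgn (sympl P Q)) (pauli Q' ** pauli P') ** dagger (pauli Q' ** pauli P')"
    by (simp only:)
  moreover have "(pauli Q' ** pauli P') ** dagger (pauli Q' ** pauli P') = mat 1"
    using unitary_mult[OF unitary_pauli unitary_pauli] unitary_mat_def by metis
  ultimately have "cscale (z * w * bsgn (sympl P' Q')) (mat 1 :: 'a qop) = cscale (z * w * bsgn (sympl P Q)) (mat 1)"
    by (simp only: cscale_mult_left)
  then have "cscale (z * w * bsgn (sympl P' Q')) (mat 1 :: 'a qop) $ 0 $ 0 = cscale (z * w * bsgn (sympl P Q)) (mat 1 :: 'a qop) $ 0 $ 0"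
    by (simp only:)
  then have "z * w * bsgn (sympl P' Q') = z * w * bsgn (sympl P Q)" by (simp add: mat_def)
  moreover have "z \<noteq> 0" "w \<noteq> 0" using P(2) Q(2) by auto
  ultimately have "bsgn (sympl P' Q') = bsgn (sympl P Q)" by simp
  then show ?thesis by (cases "sympl P' Q'"; cases "sympl P Q") simp_all
qed

text \<open>Injectivity of F is derived from the unitary that induces it: the form is preserved and
  nondegenerate.\<close>

lemma induces_sp_act_nonzero:
  assumes g: "unitary_mat g" "induces g F" and "P \<noteq> 0"
  shows "sp_act F P \<noteq> 0"
proof
  assume 0: "sp_act F P = 0"
  obtain R where "sympl P R = 1" using sympl_nondegenerate assms(3) by blast
  moreover have "sympl (sp_act F P) (sp_act F R) = sympl P R"
    using induces_conj[OF g(2), of P] induces_conj[OF g(2), of R] conj_preserves_sympl[OF g(1)] by blast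
  ultimately show False using 0 by simp
qed

lemma sum_bsgn_sympl:
  assumes "S \<noteq> 0"
  shows "(\<Sum>R\<in>UNIV. bsgn (sympl R S)) = 0"
proof -
  obtain R0 where "sympl S R0 = 1" using sympl_nondegenerate[OF assms] by blast
  then have R0: "sympl R0 S = 1" by (simp add: sympl_commute)
  have "(\<Sum>R\<in>UNIV. bsgn (sympl R S)) = (\<Sum>R\<in>UNIV. bsgn (sympl (R0 + R) S))"
    by (rule sum.reindex_bij_witness[of _ "\<lambda>R. R0 + R" "\<lambda>R. R0 + R"]) simp_all
  also have "\<dots> = - (\<Sum>R\<in>UNIV. bsgn (sympl R S))"
    using R0 by (simp add: sympl_add_left bsgn_add sum_negf)
  finally have "2 * (\<Sum>R\<in>UNIV. bsgn (sympl R S)) = 0" by (simp only: mult_2 add.right_inverse) simp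
  then show ?thesis by simp
qed

section \<open>Transitive symplectic groups give 2-designs\<close>

lemma distinct_2: "(1 :: 2) \<noteq> 2" "(2 :: 2) \<noteq> 1"
  by simp_all

context
  fixes G :: "'m::finite sp_mat set" and g :: "'m sp_mat \<Rightarrow> 'm qop"
  assumes G_nonempty: "G \<noteq> {}"
    and G_mult: "\<And>F F'. F \<in> G \<Longrightarrow> F' \<in> G \<Longrightarrow> F ** F' \<in> G"
    and g: "\<And>F. F \<in> G \<Longrightarrow> unitary_mat (g F)" "\<And>F. F \<in> G \<Longrightarrow> induces (g F) F"
    and transitive: "\<exists>P0. \<forall>P. P \<noteq> 0 \<longrightarrow> (\<exists>F\<in>G. sp_act F P = P0)"
begin

definition "pauli_ensemble = (\<lambda>(F, P). pauli P ** g F)"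

abbreviation "ptwirl \<equiv> (ensemble_twirl (G \<times> UNIV) pauli_ensemble :: complex^('m bits^2)^('m bits^2) \<Rightarrow> _)"

lemma pauli_ensemble_unitary: "x \<in> G \<times> UNIV \<Longrightarrow> unitary_mat (pauli_ensemble x)"
  by (auto simp: pauli_ensemble_def intro: unitary_mult unitary_pauli g)

lemma ptwirl_fixed:
  assumes "X \<in> twirl_fixed"
  shows "ptwirl X \<in> twirl_fixed"
proof -
  have "ptwirl X = X"
    using G_nonempty twirl_fixedD[OF assms] pauli_ensemble_unitary by (intro ensemble_twirl_const) auto
  then show ?thesis using assms by simp
qed

lemma ptwirl_eq: "ptwirl X = (1 / real (card (G \<times> (UNIV :: 'm pauli_label set)))) *\<^sub>R
    (\<Sum>F\<in>G. \<Sum>R\<in>UNIV. tensor_conj (pauli R) (tensor_conj (g F) X))"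
proof -
  have "ptwirl X = (1 / real (card (G \<times> (UNIV :: 'm pauli_label set)))) *\<^sub>R
      (\<Sum>x\<in>G \<times> UNIV. tensor_conj (pauli_ensemble x) X)"
    unfolding ensemble_twirl_def by (simp only: scaleR_sum_right)
  also have "(\<Sum>x\<in>G \<times> UNIV. tensor_conj (pauli_ensemble x) X) =
      (\<Sum>F\<in>G. \<Sum>R\<in>UNIV. tensor_conj (pauli R) (tensor_conj (g F) X))"
    unfolding sum.cartesian_product pauli_ensemble_def case_prod_unfold tensor_conj_comp by (rule refl)
  finally show ?thesis .
qed

text \<open>F keeps the total label nonzero, so the inner average over R is a vanishing character
  sum for each F.\<close>

lemma ptwirl_pauli_tensor_eq_0:
  assumes "f 1 \<noteq> f (2 :: 2)"
  shows "ptwirl (tensor (\<lambda>i. pauli (f i))) = 0"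
proof -
  have "(\<Sum>R\<in>UNIV. tensor_conj (pauli R) (tensor_conj (g F) (tensor (\<lambda>i. pauli (f i))))) = 0" if F: "F \<in> G" for F
  proof -
    define f' where "f' i = sp_act F (f i)" for i
    have "\<forall>P. \<exists>z. cmod z = 1 \<and> g F ** pauli P ** dagger (g F) = cscale z (pauli (sp_act F P))"
      using induces_conj[OF g(2)[OF F]] by blast
    then obtain z where z: "\<And>P. g F ** pauli P ** dagger (g F) = cscale (z P) (pauli (sp_act F P))" by metis
    have "f 1 + f 2 \<noteq> 0" using assms by (simp add: label_add_eq_0)
    then have "sp_act F (f 1 + f 2) \<noteq> 0" by (rule induces_sp_act_nonzero[OF g[OF F]])
    then have nz: "(\<Sum>i\<in>UNIV. f' i) \<noteq> 0" by (simp add: sum_2 f'_def sp_act_add)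
    have "tensor_conj (g F) (tensor (\<lambda>i. pauli (f i))) = cscale (\<Prod>i\<in>UNIV. z (f i)) (tensor (\<lambda>i. pauli (f' i)))"
      by (simp add: tensor_conj_tensor z tensor_cscale f'_def)
    then have "(\<Sum>R\<in>UNIV. tensor_conj (pauli R) (tensor_conj (g F) (tensor (\<lambda>i. pauli (f i))))) =
       (\<Sum>R\<in>UNIV. cscale (bsgn (sympl R (\<Sum>i\<in>UNIV. f' i)))
         (cscale (\<Prod>i\<in>UNIV. z (f i)) (tensor (\<lambda>i. pauli (f' i)))))"
      by (simp add: tensor_conj_cscale tensor_conj_pauli_tensor mult.commute)
    also have "\<dots> = cscale (\<Sum>R\<in>UNIV. bsgn (sympl R (\<Sum>i\<in>UNIV. f' i)))
         (cscale (\<Prod>i\<in>UNIV. z (f i)) (tensor (\<lambda>i. pauli (f' i))))"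
      by (simp only: vec_eq_iff sum_component cscale_nth sum_distrib_right) simp
    also have "\<dots> = 0" by (simp only: sum_bsgn_sympl[OF nz] cscale_zero)
    finally show ?thesis .
  qed
  then show ?thesis by (simp only: ptwirl_eq sum.neutral_const cong: sum.cong) simp
qed

text \<open>All phases cancel, so this twirl depends on the matrices F alone and not on the lifts
  \<open>g F\<close>. Hence multiplication inside G can be exploited.\<close>

lemma ptwirl_pair_eq:
  "ptwirl (pair_tensor 1 2 P) = (1 / real (card (G \<times> (UNIV :: 'm pauli_label set)))) *\<^sub>R
    (\<Sum>F\<in>G. \<Sum>R\<in>(UNIV :: 'm pauli_label set). pair_tensor 1 2 (sp_act F P))"
proof -
  have "tensor_conj (pauli R) (tensor_conj (g F) (pair_tensor 1 2 P)) = (pair_tensor 1 2 (sp_act F P) :: complex^('m bits^2)^('m bits^2))"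
    if F: "F \<in> G" for F R
  proof -
    obtain z where "cmod z = 1" "g F ** pauli P ** dagger (g F) = cscale z (pauli (sp_act F P))"
      using induces_conj[OF g(2)[OF F]] by blast
    then have "tensor_conj (g F) (pair_tensor 1 2 P) = (pair_tensor 1 2 (sp_act F P) :: complex^('m bits^2)^('m bits^2))"
      by (intro tensor_conj_pair_tensor[OF g(1)[OF F] distinct_2(1)])
    moreover have "tensor_conj (pauli R) (pair_tensor 1 2 (sp_act F P)) =
       (pair_tensor 1 2 (sp_act F P) :: complex^('m bits^2)^('m bits^2))"
      by (rule tensor_conj_pair_tensor[OF unitary_pauli distinct_2(1) pauli_conj]) simp
    ultimately show ?thesis by simp
  qed
  then show ?thesis unfolding ptwirl_eq by (intro arg_cong[of _ _ "scaleR _"] sum.cong refl)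
qed

text \<open>Left multiplication by F' is injective on the finite set G, because F' acts surjectively
  on labels; it therefore reindexes the sum.\<close>

lemma ptwirl_pair_invariant:
  assumes F': "F' \<in> G"
  shows "ptwirl (pair_tensor 1 2 (sp_act F' P)) = ptwirl (pair_tensor 1 2 P)"
proof -
  have "inj (sp_act F')"
  proof (rule injI)
    fix P Q assume "sp_act F' P = sp_act F' Q"
    then have "sp_act F' (P + Q) = 0" by (simp add: sp_act_add label_add_eq_0)
    then have "P + Q = 0" using induces_sp_act_nonzero[OF g[OF F']] by blast
    then show "P = Q" by (simp add: label_add_eq_0)
  qed
  then have surj: "surj (sp_act F')" by (rule finite_UNIV_inj_surj[OF finite])
  have "inj_on (\<lambda>F. F' ** F) G"
  proof (rule inj_onI)
    fix F F2 :: "'m sp_mat" assume "F' ** F = F' ** F2"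
    then have "sp_act F (sp_act F' P) = sp_act F2 (sp_act F' P)" for P
      by (metis sp_act_mult)
    then show "F = F2" using surj by (intro sp_act_eqD) (metis surjD)
  qed
  then have bij: "bij_betw (\<lambda>F. F' ** F) G G"
    unfolding bij_betw_def using endo_inj_surj[OF finite, of "\<lambda>F. F' ** F" G] G_mult[OF F'] by blast
  show ?thesis
    unfolding ptwirl_pair_eq sp_act_mult[symmetric]
    by (intro arg_cong[of _ _ "scaleR _"] sum.reindex_bij_betw[OF bij])
qed

text \<open>Every nonzero label is compared with the common target P0, so the twirl is constant on P
  \<noteq> 0; the sum over these labels is a multiple of the swap minus the identity.\<close>

lemma ptwirl_pair_fixed: "ptwirl (pair_tensor 1 2 P) \<in> twirl_fixed"
proof (cases "P = 0")
  case True
  then show ?thesis by (simp add: ptwirl_fixed twirl_fixed_closed)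
next
  case False
  obtain P0 where "\<And>Q. Q \<noteq> 0 \<Longrightarrow> \<exists>F\<in>G. sp_act F Q = P0" using transitive by blast
  then have "ptwirl (pair_tensor 1 2 Q) = ptwirl (pair_tensor 1 2 P0)" if "Q \<noteq> 0" for Q
    using that ptwirl_pair_invariant by metis
  then have c: "ptwirl (pair_tensor 1 2 Q) = ptwirl (pair_tensor 1 2 P)" if "Q \<noteq> 0" for Q
    using that False by metis
  have "(\<Sum>P\<in>UNIV - {0}. ptwirl (pair_tensor 1 2 P)) = (\<Sum>P\<in>UNIV. ptwirl (pair_tensor 1 2 P)) - ptwirl (mat 1)"
    by (simp add: sum_diff)
  also have "\<dots> \<in> twirl_fixed"
    unfolding ensemble_twirl_sum[symmetric]
    by (intro twirl_fixed_closed ptwirl_fixed sum_pair_tensor_fixed distinct_2)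
  finally have sum: "(\<Sum>P\<in>UNIV - {0}. ptwirl (pair_tensor 1 2 P)) \<in> twirl_fixed" .
  show ?thesis
  proof (rule constant_summand_fixed[where S = "UNIV - {0}" and A = "\<lambda>P. ptwirl (pair_tensor 1 2 P)"])
    show "ptwirl (pair_tensor 1 2 P') = ptwirl (pair_tensor 1 2 P)" if "P' \<in> UNIV - {0}" for P'
      by (rule c) (use that in simp)
  qed (use False sum in simp_all)
qed

lemma ptwirl_pauli_tensor_fixed: "ptwirl (tensor (\<lambda>i. pauli (f i))) \<in> twirl_fixed"
proof (cases "f 1 = f 2")
  case False
  then show ?thesis by (simp add: ptwirl_pauli_tensor_eq_0 twirl_fixed_zero)
next
  case True
  let ?s = "bsgn (bdot (fst (f 1)) (snd (f 1)))"
  have "pauli (f i) = cscale (if i = 2 then ?s else 1) (if i = 1 then pauli (f 1) else if i = 2 then dagger (pauli (f 1)) else mat 1)"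
    for i :: 2
    using exhaust_2[of i] True by (elim disjE) (simp_all add: distinct_2 pauli_dagger)
  then have "tensor (\<lambda>i. pauli (f i)) = tensor (\<lambda>i::2. cscale (if i = 2 then ?s else 1)
      (if i = 1 then pauli (f 1) else if i = 2 then dagger (pauli (f 1)) else mat 1))"
    by (intro arg_cong[of _ _ tensor] ext)
  also have "\<dots> = cscale (\<Prod>i\<in>UNIV. if i = (2::2) then ?s else 1) (pair_tensor 1 2 (f 1))"
    unfolding tensor_cscale pair_tensor_def by (rule refl)
  finally show ?thesis by (simp only: ensemble_twirl_cscale twirl_fixed_closed ptwirl_pair_fixed)
qed

theorem transitive_2_design:
  assumes "haar_unitary \<eta>"
  shows "uniform_unitary_design TYPE(2) \<eta> (G \<times> UNIV) (\<lambda>(F, a, b). pauli_D a b ** g F)"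
proof -
  have "pauli_ensemble = (\<lambda>(F, a, b). pauli_D a b ** g F)"
    by (auto simp: pauli_ensemble_def pauli_def)
  moreover have "uniform_unitary_design TYPE(2) \<eta> (G \<times> UNIV) pauli_ensemble"
  proof (rule uniform_design_criterion[OF assms])
    show "G \<times> (UNIV :: 'm pauli_label set) \<noteq> {}" using G_nonempty by simp
    show "ptwirl X \<in> twirl_fixed" for X
      by (rule ensemble_twirl_fixedI) (rule ptwirl_pauli_tensor_fixed)
  qed (simp_all only: finite pauli_ensemble_unitary)
  ultimately show ?thesis by simp
qed

end

section \<open>Transitivity of the Kerdock groups\<close>

lemma row_pair_block_mat:
  fixes a b :: "'m::finite bits"
  shows "row_pair a b v* block_mat A B C D = row_pair (a v* A + b v* C) (a v* B + b v* D)"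
proof -
  have "(\<Sum>s\<in>(UNIV :: ('m + 'm) set). h s) = (\<Sum>i\<in>UNIV. h (Inl i)) + (\<Sum>i\<in>UNIV. h (Inr i))"
    for h :: "'m + 'm \<Rightarrow> bit"
    using sum.Plus[of "UNIV :: 'm set" "UNIV :: 'm set" h] by simp
  then show ?thesis
    by (simp add: vec_eq_iff vector_matrix_mult_def row_pair_def block_mat_def split: sum.split)
qed

lemma sp_act_block_mat: "sp_act (block_mat A B C D) (a, b) = (a v* A + b v* C, a v* B + b v* D)"
  by (simp add: sp_act_def row_pair_block_mat)

lemma sp_act_generators:
  "sp_act (T_mat M) (a, b) = (a, a v* M + b)"
  "sp_act (L_mat M) (a, b) = (a v* M, b v* transpose (matrix_inv M))"
  "sp_act Omega (a, b) = (b, a)"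
  by (simp_all add: T_mat_def L_mat_def Omega_def sp_act_block_mat)

lemma matrix_inv_mult_left: "invertible A \<Longrightarrow> matrix_inv A ** A = mat 1"
  unfolding invertible_def matrix_inv_def by (metis (mono_tags, lifting) someI_ex)

section \<open>Multiplication matrices and the trace form in coordinates\<close>

context
  fixes q :: "bit poly" and \<alpha> :: "'f::field"
  assumes irr: "irreducible q" and deg: "degree q = CARD('m::{finite,linorder})" and adj: "adjoins_root q \<alpha>"
begin

lemmas field_setup = irr deg adj

lemma elt_inject: "elt \<alpha> (x :: 'm bits) = elt \<alpha> y \<longleftrightarrow> x = y"
  using bij_elt[OF field_setup] by (auto simp: bij_def dest: injD)

lemma elt_eq_0: "elt \<alpha> (x :: 'm bits) = 0 \<longleftrightarrow> x = 0"
proof -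
  have "elt \<alpha> (0 :: 'm bits) = 0" by (simp add: elt_def)
  then show ?thesis using elt_inject by metis
qed

lemma A_mat_invertible:
  assumes "x \<noteq> 0"
  shows "matrix_inv (A_mat \<alpha> x :: 'm bmat) ** A_mat \<alpha> x = mat 1"
proof -
  have "A_mat \<alpha> y ** A_mat \<alpha> z = (mat 1 :: 'm bmat)" if "y * z = 1" for y z
    by (rule bmat_eqI)
      (simp add: elt_inject[symmetric] vector_matrix_mul_assoc[symmetric] A_mat_works[OF field_setup] mult.assoc that)
  from this[of x "1 / x"] this[of "1 / x" x] have "invertible (A_mat \<alpha> x :: 'm bmat)"
    using assms unfolding invertible_def by (metis nonzero_divide_eq_eq times_divide_eq_right mult.right_neutral divide_self)
  then show ?thesis by (rule matrix_inv_mult_left)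
qed

lemma elt_A_mat_inv:
  assumes "x \<noteq> 0"
  shows "elt \<alpha> (w v* matrix_inv (A_mat \<alpha> x) :: 'm bits) * x = elt \<alpha> w"
  by (simp add: A_mat_works[OF field_setup, symmetric] vector_matrix_mul_assoc A_mat_invertible[OF assms])

text \<open>The trace is given by a nonzero polynomial, with coefficient 1 at the linear term, whose
  degree is smaller than the size of the field.\<close>

lemma field_trace_nonzero: "\<exists>x. field_trace CARD('m) (x :: 'f) \<noteq> 0"
proof (rule ccontr)
  assume *: "\<not> ?thesis"
  define p :: "'f poly" where "p = (\<Sum>i<CARD('m). monom 1 (2 ^ i))"
  have bij: "bij (elt \<alpha> :: 'm bits \<Rightarrow> 'f)" by (rule bij_elt[OF field_setup])
  have "CARD(bit) = 2" unfolding UNIV_bit by (simp del: bit_not_zero_iff)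
  then have card: "CARD('f) = 2 ^ CARD('m)"
    using bij_betw_same_card[OF bij] by simp
  have "coeff p 1 = (\<Sum>i<CARD('m). if i = 0 then 1 else 0)"
    unfolding p_def coeff_sum by (rule sum.cong) (auto simp: coeff_monom)
  then have "coeff p 1 = 1" by simp
  then have "p \<noteq> 0" by auto
  moreover have "poly p x = 0" for x
    using * by (simp add: p_def poly_sum poly_monom field_trace_def)
  ultimately have "card (UNIV :: 'f set) \<le> degree p"
    using card_poly_roots_bound[of p] by simp
  moreover have "degree p \<le> 2 ^ (CARD('m) - 1)"
    unfolding p_def by (intro degree_sum_le) (auto intro!: order_trans[OF degree_monom_le] power_increasing)
  moreover have "(2 :: nat) ^ (CARD('m) - 1) < 2 ^ CARD('m)" by (rule power_strict_increasing) auto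
  ultimately show False using card by linarith
qed

text \<open>Nondegeneracy of the trace form: for x \<noteq> 0 the element t / x pairs with x to an
  element t of nonzero trace.\<close>

lemma W_mat_kernel:
  assumes "(x :: 'm bits) v* W_mat \<alpha> = 0"
  shows "x = 0"
proof (rule ccontr)
  assume "x \<noteq> 0"
  then have x: "elt \<alpha> x \<noteq> 0" by (simp add: elt_eq_0)
  obtain t :: 'f where t: "field_trace CARD('m) t \<noteq> 0" using field_trace_nonzero by blast
  define y :: "'m bits" where "y = coords \<alpha> (t / elt \<alpha> x)"
  have "elt \<alpha> x * elt \<alpha> y = t" using x by (simp add: y_def elt_coords[OF field_setup])
  then show False using W_mat_works[OF field_setup, of x y] t assms by simp
qed

lemma W_mat_surj: "\<exists>x :: 'm bits. x v* W_mat \<alpha> = b"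
proof -
  have "inj (\<lambda>x :: 'm bits. x v* W_mat \<alpha>)"
  proof (rule injI)
    fix x y :: "'m bits" assume "x v* W_mat \<alpha> = y v* W_mat \<alpha>"
    then have "(x + y) v* W_mat \<alpha> = 0" by (simp add: vector_matrix_left_distrib)
    then show "x = y" using W_mat_kernel by (metis add.right_neutral bits_add_self_left)
  qed
  then show ?thesis using finite_UNIV_inj_surj[OF finite] by (metis surjD)
qed

text \<open>\<open>matrix_inv\<close> is a choice, so a two-sided inverse has to be exhibited: the
  matrix of the inverse map, which is additive and hence linear over the field with two
  elements.\<close>

lemma W_mat_invertible: "matrix_inv (W_mat \<alpha> :: 'm bmat) ** W_mat \<alpha> = mat 1"
proof -
  obtain h where h: "\<And>b :: 'm bits. h b v* W_mat \<alpha> = b" using W_mat_surj by metis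
  have u: "h (x v* W_mat \<alpha>) = x" for x
  proof -
    have "(h (x v* W_mat \<alpha>) + x) v* W_mat \<alpha> = 0" by (simp add: vector_matrix_left_distrib h)
    then show ?thesis using W_mat_kernel by (metis add.commute add.right_neutral bits_add_self_left)
  qed
  have add: "h (a + b) = h a + h b" for a b
    using u[of "h a + h b"] by (simp add: vector_matrix_left_distrib h)
  have V: "x v* row_matrix h = h x" for x by (rule row_matrix_works[OF add])
  have "row_matrix h ** W_mat \<alpha> = mat 1" "W_mat \<alpha> ** row_matrix h = mat 1"
    by (rule bmat_eqI; simp add: vector_matrix_mul_assoc[symmetric] V h u)+
  then have "invertible (W_mat \<alpha> :: 'm bmat)" unfolding invertible_def by blast
  then show ?thesis by (rule matrix_inv_mult_left)
qed

lemma square_root: "\<exists>y :: 'f. y\<^sup>2 = x"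
proof -
  have "(x ^ (2 ^ (CARD('m) - 1)))\<^sup>2 = x ^ (2 ^ CARD('m))"
    by (simp add: power_mult[symmetric] power_Suc2[symmetric])
  also have "\<dots> = x" by (rule field_power_card[OF field_setup])
  finally show ?thesis by blast
qed

text \<open>A label (a, b) with a \<noteq> 0 goes to (a, 0) by some T and then to (1, 0) by dividing
  by a; if a = 0, the swap with \<open>W_mat\<close> makes the first component nonzero. Only
  generators common to both groups occur, so one proof serves both.\<close>

lemma kerdock_transitive:
  fixes G :: "'m sp_mat set"
  assumes T: "\<And>x. T_mat (A_mat \<alpha> x ** A_mat \<alpha> x ** W_mat \<alpha>) \<in> G"
    and L: "\<And>x. x \<noteq> 0 \<Longrightarrow> L_mat (matrix_inv (A_mat \<alpha> x)) \<in> G"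
    and O: "Omega ** L_mat (matrix_inv (W_mat \<alpha>)) \<in> G"
    and mult: "\<And>F F'. F \<in> G \<Longrightarrow> F' \<in> G \<Longrightarrow> F ** F' \<in> G"
  shows "\<exists>P0. \<forall>P. P \<noteq> 0 \<longrightarrow> (\<exists>F\<in>G. sp_act F P = P0)"
proof -
  define P0 :: "'m pauli_label" where "P0 = (coords \<alpha> 1, 0)"
  have 1: "\<exists>F\<in>G. sp_act F (a, b) = P0" if a: "a \<noteq> 0" for a b :: "'m bits"
  proof -
    have ea: "elt \<alpha> a \<noteq> 0" using a by (simp add: elt_eq_0)
    obtain \<beta> :: "'m bits" where \<beta>: "\<beta> v* W_mat \<alpha> = b" using W_mat_surj by blast
    \<comment> \<open>T uses the square of x, so a square root is taken; then T adds b to the second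
      component and cancels it in characteristic two.\<close>
    obtain x where x: "x\<^sup>2 = elt \<alpha> \<beta> / elt \<alpha> a" using square_root by blast
    have "elt \<alpha> (a v* A_mat \<alpha> x v* A_mat \<alpha> x) = elt \<alpha> \<beta>"
      using x ea by (simp add: A_mat_works[OF field_setup] mult.assoc power2_eq_square)
    then have "a v* A_mat \<alpha> x v* A_mat \<alpha> x = \<beta>" by (simp add: elt_inject)
    then have t: "sp_act (T_mat (A_mat \<alpha> x ** A_mat \<alpha> x ** W_mat \<alpha>)) (a, b) = (a, 0)"
      by (simp add: sp_act_generators vector_matrix_mul_assoc[symmetric] \<beta>)
    let ?L = "L_mat (matrix_inv (A_mat \<alpha> (elt \<alpha> a))) :: 'm sp_mat"
    have "elt \<alpha> (a v* matrix_inv (A_mat \<alpha> (elt \<alpha> a))) * elt \<alpha> a = 1 * elt \<alpha> a"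
      by (simp add: elt_A_mat_inv[OF ea])
    then have "elt \<alpha> (a v* matrix_inv (A_mat \<alpha> (elt \<alpha> a))) = elt \<alpha> (coords \<alpha> 1 :: 'm bits)"
      unfolding elt_coords[OF field_setup] using ea by (simp only: mult_cancel_right) simp
    then have "sp_act ?L (a, 0) = P0"
      by (simp add: sp_act_generators P0_def elt_inject)
    then have "sp_act (T_mat (A_mat \<alpha> x ** A_mat \<alpha> x ** W_mat \<alpha>) ** ?L) (a, b) = P0"
      by (simp add: sp_act_mult t)
    then show ?thesis using mult[OF T L[OF ea]] by blast
  qed
  have "\<exists>F\<in>G. sp_act F (a, b) = P0" if "(a, b) \<noteq> 0" for a b :: "'m bits"
  proof (cases "a = 0")
    case False
    then show ?thesis by (rule 1)
  next
    case True
    then have b: "b \<noteq> 0" using that by (simp add: zero_prod_def)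
    let ?O = "Omega ** L_mat (matrix_inv (W_mat \<alpha>)) :: 'm sp_mat"
    define a' where "a' = b v* matrix_inv (W_mat \<alpha>)"
    have "a' v* W_mat \<alpha> = b" by (simp add: a'_def vector_matrix_mul_assoc W_mat_invertible)
    then have a': "a' \<noteq> 0" using b by auto
    obtain b' where b': "sp_act ?O (a, b) = (a', b')" by (simp add: sp_act_mult sp_act_generators a'_def)
    obtain F where "F \<in> G" "sp_act F (a', b') = P0" using 1[OF a'] by blast
    then have "sp_act (?O ** F) (a, b) = P0" "?O ** F \<in> G" using b' O mult by (simp_all add: sp_act_mult)
    then show ?thesis by blast
  qed
  then show ?thesis by (metis prod.exhaust)
qed

end

theorem corollary36:
  fixes \<eta> :: "('m::{finite,linorder} qop) measure"
  assumes "haar_unitary \<eta>"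
  shows
    "(\<forall>rep :: 'm qop set \<Rightarrow> 'm qop.
        (\<forall>C \<in> Cliff // cliff_phase_rel. rep C \<in> C) \<longrightarrow>
        uniform_unitary_design TYPE(3) \<eta> (Cliff // cliff_phase_rel) rep) \<and>
     (\<forall>(q :: bit poly) (\<alpha> :: 'f::field) (G :: 'm sp_mat set) (g :: 'm sp_mat \<Rightarrow> 'm qop).
        primitive_irreducible q \<longrightarrow> degree q = CARD('m) \<longrightarrow> adjoins_root q \<alpha> \<longrightarrow>
        G \<in> {P_K \<alpha>, P_K_star \<alpha>} \<longrightarrow>
        (\<forall>F \<in> G. g F \<in> Cliff \<and> induces (g F) F) \<longrightarrow>
        uniform_unitary_design TYPE(2) \<eta> (G \<times> UNIV) (\<lambda>(F, a, b). pauli_D a b ** g F))"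
proof (intro conjI allI impI)
  fix rep :: "'m qop set \<Rightarrow> 'm qop"
  assume "\<forall>C \<in> Cliff // cliff_phase_rel. rep C \<in> C"
  then show "uniform_unitary_design TYPE(3) \<eta> (Cliff // cliff_phase_rel) rep"
    using assms by (rule clifford_3_design)
next
  fix q :: "bit poly" and \<alpha> :: 'f and G :: "'m sp_mat set" and g :: "'m sp_mat \<Rightarrow> 'm qop"
  assume q: "primitive_irreducible q" and deg: "degree q = CARD('m)" and adj: "adjoins_root q \<alpha>"
    and G: "G \<in> {P_K \<alpha>, P_K_star \<alpha>}" and g: "\<forall>F \<in> G. g F \<in> Cliff \<and> induces (g F) F"
  have irr: "irreducible q" using q by (simp add: primitive_irreducible_def)
  obtain H where H: "G = generate GL H"
    and T: "\<And>x. T_mat (A_mat \<alpha> x ** A_mat \<alpha> x ** W_mat \<alpha>) \<in> H"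
    and L: "\<And>x. x \<noteq> 0 \<Longrightarrow> L_mat (matrix_inv (A_mat \<alpha> x)) \<in> H"
    and O: "Omega ** L_mat (matrix_inv (W_mat \<alpha>)) \<in> H"
  proof (cases "G = P_K \<alpha>")
    case True
    show ?thesis by (rule that[OF True[unfolded P_K_def]]) auto
  next
    case False
    then have G: "G = P_K_star \<alpha>" using G by blast
    \<comment> \<open>The power i = 0 of the inverse Frobenius matrix recovers the generators of the
      smaller family.\<close>
    have "\<exists>i y. L_mat (matrix_inv (A_mat \<alpha> x)) =
        L_mat (mat_power (matrix_inv (R_mat \<alpha> :: 'm bmat)) i ** matrix_inv (A_mat \<alpha> y)) \<and> i < CARD('m) \<and> y \<noteq> 0"
      if "x \<noteq> 0" for x
      using that by (intro exI[of _ 0] exI[of _ x]) (simp add: mat_power_def)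
    then show ?thesis by (intro that[OF G[unfolded P_K_star_def]]) auto
  qed
  have mult: "F ** F' \<in> G" if "F \<in> G" "F' \<in> G" for F F'
    using generate.eng[of F GL H F'] that by (simp add: H GL_def)
  have "\<exists>P0. \<forall>P. P \<noteq> 0 \<longrightarrow> (\<exists>F\<in>G. sp_act F P = P0)"
    by (rule kerdock_transitive[OF irr deg adj]) (use T L O mult in \<open>auto simp: H intro: generate.incl\<close>)
  moreover have "G \<noteq> {}" using generate.one[of GL H] H by auto
  ultimately show "uniform_unitary_design TYPE(2) \<eta> (G \<times> UNIV) (\<lambda>(F, a, b). pauli_D a b ** g F)"
    using mult g Cliff_unitary assms by (intro transitive_2_design) blast+
qed

end
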